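(* Let $0<\kappa<1$, $0<a\le\sqrt{1/2}$, and let $W_{(\alpha,\beta)}\equiv(T_1,T_2)$ be the $2$-variable weighted shift described in the context. Then (i) $W_{(\alpha,\beta)}\in\mathfrak H_0$; (ii) $W_{(\alpha,\beta)}\in\mathfrak H_2\iff\kappa\le h_2(a):=\sqrt{\dfrac{9(9-16a^2)}{157-360a^2+144a^4}}$; (iii) $W_{(\alpha,\beta)}^{(2,1)}\in\mathfrak H_2\iff\kappa\le h_2^{(2,1)}(a):=\sqrt{\dfrac{225(15-28a^2)}{6238-15015a^2+6300a^4}}$; (iv) $h_2(a)<h_2^{(2,1)}(a)$ for $a\in(0,\sqrt{1/2}]$.
   Context: Given bounded families of positive numbers $\alpha_{\mathbf k},\beta_{\mathbf k}$ ($\mathbf k\in\mathbb Z_+^2$), the $2$-variable weighted shift $W_{(\alpha,\beta)}\equiv(T_1,T_2)$ on $\ell^2(\mathbb Z_+^2)$ with canonical orthonormal basis $\{e_{\mathbf k}\}$ is $T_1e_{\mathbf k}:=\alpha_{\mathbf k}e_{\mathbf k+(1,0)}$, $T_2e_{\mathbf k}:=\beta_{\mathbf k}e_{\mathbf k+(0,1)}$. Its powers are $W_{(\alpha,\beta)}^{(h,\ell)}:=(T_1^h,T_2^\ell)$; thus $W_{(\alpha,\beta)}^{(2,1)}=(T_1^2,T_2)$. An $n$-tuple $(S_1,\dots,S_n)$ of Hilbert space operators is (jointly) hyponormal if the operator matrix with $(i,j)$ entry $[S_j^*,S_i]=S_j^*S_i-S_iS_j^*$ is positive. A commuting pair $(T_1,T_2)$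 is $2$-hyponormal if the tuple $(T_1,T_2,T_1^2,T_2T_1,T_2^2)$ is hyponormal. $\mathfrak H_0$ is the set of commuting pairs of subnormal operators, and $\mathfrak H_2$ is the set of $2$-hyponormal pairs in $\mathfrak H_0$. The shift in question: let $x_0:=\kappa\sqrt{3/4}$, $x_n:=\frac{\sqrt{(n+1)(n+3)}}{n+2}$ for $n\ge1$, and $y:=\kappa$. The weights are $\alpha_{(n,0)}:=x_n$ ($n\ge0$); $\alpha_{(0,j)}:=a$ ($j\ge1$); $\alpha_{(i,j)}:=1$ ($i,j\ge1$); $\beta_{(0,0)}:=y$; $\beta_{(i,0)}:=\frac{ay}{x_0x_1\cdots x_{i-1}}$ ($i\ge1$); $\beta_{(i,j)}:=1$ ($i\ge0$, $j\ge1$). *)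

theory Defs
  imports "HOL-Analysis.Analysis"
begin

section \<open>The complex Hilbert space of square-summable families\<close>

typedef 'i ell2 = "{f :: 'i \<Rightarrow> complex. (\<lambda>i. (cmod (f i))\<^sup>2) summable_on UNIV}"
  morphisms coord Abs_ell2
  by (rule exI[of _ "\<lambda>_. 0"]) simp

setup_lifting type_definition_ell2

lemma coord_summable: "(\<lambda>i. (cmod (coord f i))\<^sup>2) summable_on UNIV"
  using coord by auto

lemma ell2_eqI: "(\<And>i. coord f i = coord g i) \<Longrightarrow> f = g"
  using coord_inject by blast

lemma cmod_add_square_le: "(cmod (a + b))\<^sup>2 \<le> 2 * (cmod a)\<^sup>2 + 2 * (cmod b)\<^sup>2"
proof -
  have "(cmod (a + b))\<^sup>2 \<le> (cmod a + cmod b)\<^sup>2"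
    by (simp add: norm_triangle_ineq power_mono)
  also have "\<dots> \<le> 2 * (cmod a)\<^sup>2 + 2 * (cmod b)\<^sup>2"
    using sum_squares_bound[of "cmod a" "cmod b"] by (simp add: power2_sum)
  finally show ?thesis .
qed

lemma summable_square_add:
  assumes "(\<lambda>i. (cmod (f i))\<^sup>2) summable_on A" "(\<lambda>i. (cmod (g i))\<^sup>2) summable_on A"
  shows "(\<lambda>i. (cmod (f i + g i))\<^sup>2) summable_on A"
proof (rule summable_on_comparison_test)
  show "(\<lambda>i. 2 * (cmod (f i))\<^sup>2 + 2 * (cmod (g i))\<^sup>2) summable_on A"
    by (intro summable_on_add summable_on_cmult_right assms)
qed (auto simp: cmod_add_square_le)

lemma summable_square_mult:
  assumes "(\<lambda>i. (cmod (f i))\<^sup>2) summable_on A"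
  shows "(\<lambda>i. (cmod (c * f i))\<^sup>2) summable_on A"
  using summable_on_cmult_right[OF assms, of "(cmod c)\<^sup>2"]
  by (simp add: norm_mult power_mult_distrib)

lift_definition scaleC :: "complex \<Rightarrow> 'i ell2 \<Rightarrow> 'i ell2" (infixr "*\<^sub>C" 75)
  is "\<lambda>c f i. c * f i" using summable_square_mult by blast

text \<open>The inner product is linear in its first argument.\<close>

definition cinner :: "'i ell2 \<Rightarrow> 'i ell2 \<Rightarrow> complex"
  where "cinner f g = (\<Sum>\<^sub>\<infinity>i. coord f i * cnj (coord g i))"

lemma cinner_summable: "(\<lambda>i. coord f i * cnj (coord g i)) summable_on UNIV"
proof (rule abs_summable_summable, rule summable_on_comparison_test)
  show "(\<lambda>i. (cmod (coord f i))\<^sup>2 + (cmod (coord g i))\<^sup>2) summable_on UNIV"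
    by (intro summable_on_add coord_summable)
  show "norm (coord f i * cnj (coord g i)) \<le> (cmod (coord f i))\<^sup>2 + (cmod (coord g i))\<^sup>2" for i
  proof -
    have "2 * (cmod (coord f i) * cmod (coord g i)) \<le> (cmod (coord f i))\<^sup>2 + (cmod (coord g i))\<^sup>2"
      using sum_squares_bound[of "cmod (coord f i)" "cmod (coord g i)"] by simp
    moreover have "0 \<le> cmod (coord f i) * cmod (coord g i)" by simp
    ultimately show ?thesis unfolding norm_mult complex_mod_cnj by linarith
  qed
qed simp

lemma Re_cinner_self: "Re (cinner x x) = (\<Sum>\<^sub>\<infinity>i. (cmod (coord x i))\<^sup>2)"
  unfolding cinner_def
  by (subst infsum_Re[OF cinner_summable, symmetric])
     (simp add: cmod_power2 flip: power2_eq_square)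

instantiation ell2 :: (type) real_inner
begin

lift_definition zero_ell2 :: "'a ell2" is "\<lambda>_. 0" by simp
lift_definition plus_ell2 :: "'a ell2 \<Rightarrow> 'a ell2 \<Rightarrow> 'a ell2" is "\<lambda>f g i. f i + g i"
  using summable_square_add by blast
lift_definition uminus_ell2 :: "'a ell2 \<Rightarrow> 'a ell2" is "\<lambda>f i. - f i" by simp
lift_definition minus_ell2 :: "'a ell2 \<Rightarrow> 'a ell2 \<Rightarrow> 'a ell2" is "\<lambda>f g i. f i - g i"
proof -
  fix f g :: "'a \<Rightarrow> complex"
  show "(\<lambda>i. (cmod (f i))\<^sup>2) summable_on UNIV \<Longrightarrow> (\<lambda>i. (cmod (g i))\<^sup>2) summable_on UNIV \<Longrightarrow>
    (\<lambda>i. (cmod (f i - g i))\<^sup>2) summable_on UNIV"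
    using summable_square_add[of f UNIV "\<lambda>i. - g i"] by simp
qed

definition scaleR_ell2 :: "real \<Rightarrow> 'a ell2 \<Rightarrow> 'a ell2"
  where "scaleR_ell2 r f = of_real r *\<^sub>C f"
definition inner_ell2 :: "'a ell2 \<Rightarrow> 'a ell2 \<Rightarrow> real"
  where "inner_ell2 f g = Re (cinner f g)"
definition norm_ell2 :: "'a ell2 \<Rightarrow> real"
  where "norm_ell2 f = sqrt (inner f f)"
definition dist_ell2 :: "'a ell2 \<Rightarrow> 'a ell2 \<Rightarrow> real"
  where "dist_ell2 f g = norm (f - g)"
definition sgn_ell2 :: "'a ell2 \<Rightarrow> 'a ell2"
  where "sgn_ell2 f = inverse (norm f) *\<^sub>R f"
definition uniformity_ell2 :: "('a ell2 \<times> 'a ell2) filter"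
  where "uniformity_ell2 = (INF e\<in>{0<..}. principal {(x, y). dist x y < e})"
definition open_ell2 :: "'a ell2 set \<Rightarrow> bool"
  where "open_ell2 U \<longleftrightarrow> (\<forall>x\<in>U. \<forall>\<^sub>F (x', y) in uniformity. x' = x \<longrightarrow> y \<in> U)"

instance
proof
  fix x y z :: "'a ell2" and r s :: real
  show "x + y + z = x + (y + z)" "x + y = y + x" "0 + x = x" "- x + x = 0" "x - y = x + - y"
    by (transfer, simp add: algebra_simps)+
  show "r *\<^sub>R (x + y) = r *\<^sub>R x + r *\<^sub>R y" "(r + s) *\<^sub>R x = r *\<^sub>R x + s *\<^sub>R x"
    "r *\<^sub>R s *\<^sub>R x = (r * s) *\<^sub>R x" "1 *\<^sub>R x = x"
    unfolding scaleR_ell2_def by (transfer, simp add: algebra_simps)+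
  show "sgn x = inverse (norm x) *\<^sub>R x" "dist x y = norm (x - y)" "norm x = sqrt (inner x x)"
    "uniformity = (INF e\<in>{0<..}. principal {(x::'a ell2, y). dist x y < e})"
    by (simp_all add: sgn_ell2_def dist_ell2_def norm_ell2_def uniformity_ell2_def)
  show "open U = (\<forall>x\<in>U. \<forall>\<^sub>F (x', y) in uniformity. x' = x \<longrightarrow> y \<in> U)" for U :: "'a ell2 set"
    by (simp add: open_ell2_def)
  have "cinner y x = cnj (cinner x y)"
    unfolding cinner_def by (simp flip: infsum_cnj add: mult.commute)
  then show "inner x y = inner y x"
    by (simp add: inner_ell2_def)
  show "inner (x + y) z = inner x z + inner y z"
    unfolding inner_ell2_def cinner_def plus_ell2.rep_eq
    by (simp add: distrib_right infsum_add cinner_summable)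
  show "inner (r *\<^sub>R x) y = r * inner x y"
    unfolding inner_ell2_def cinner_def scaleR_ell2_def scaleC.rep_eq
    by (simp add: mult.assoc infsum_cmult_right')
  have sq: "inner x x = (\<Sum>\<^sub>\<infinity>i. (cmod (coord x i))\<^sup>2)"
    unfolding inner_ell2_def by (rule Re_cinner_self)
  show "0 \<le> inner x x"
    unfolding sq by (rule infsum_nonneg) simp
  show "inner x x = 0 \<longleftrightarrow> x = 0"
  proof
    assume "inner x x = 0"
    then have "(cmod (coord x i))\<^sup>2 = 0" for i
      unfolding sq using nonneg_infsum_le_0D[OF _ coord_summable, of x i] by simp
    then show "x = 0" by (intro ell2_eqI) (simp add: zero_ell2.rep_eq)
  next
    assume "x = 0" then show "inner x x = 0" unfolding sq by (simp add: zero_ell2.rep_eq)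
  qed
qed

end

lemma norm_ell2_square: "(norm (x :: 'i ell2))\<^sup>2 = (\<Sum>\<^sub>\<infinity>i. (cmod (coord x i))\<^sup>2)"
  by (simp add: norm_eq_sqrt_inner inner_ell2_def Re_cinner_self infsum_nonneg)

lemma sum_coord_le_norm:
  assumes "finite F"
  shows "(\<Sum>i\<in>F. (cmod (coord x i))\<^sup>2) \<le> (norm x)\<^sup>2"
  unfolding norm_ell2_square
  by (rule finite_sum_le_infsum[OF coord_summable assms]) auto

lemma cmod_coord_le_norm: "cmod (coord x i) \<le> norm x"
  using sum_coord_le_norm[of "{i}" x] by (simp add: power2_le_iff_abs_le)

lemma Abs_ell2_bound:
  assumes "\<And>F. finite F \<Longrightarrow> (\<Sum>i\<in>F. (cmod (f i))\<^sup>2) \<le> C\<^sup>2" and "0 \<le> C"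
  shows "coord (Abs_ell2 f) = f" and "norm (Abs_ell2 f) \<le> C"
proof -
  have s: "(\<lambda>i. (cmod (f i))\<^sup>2) summable_on UNIV"
    by (rule nonneg_bdd_above_summable_on) (auto intro!: bdd_aboveI[of _ "C\<^sup>2"] assms)
  then show c: "coord (Abs_ell2 f) = f"
    by (simp add: Abs_ell2_inverse)
  have "(norm (Abs_ell2 f))\<^sup>2 \<le> C\<^sup>2"
    unfolding norm_ell2_square c by (rule infsum_le_finite_sums[OF s]) (use assms in auto)
  then show "norm (Abs_ell2 f) \<le> C" using assms(2) by (rule power2_le_imp_le)
qed

instance ell2 :: (type) complete_space
proof
  fix X :: "nat \<Rightarrow> 'a ell2" assume X: "Cauchy X"
  have "Cauchy (\<lambda>n. coord (X n) i)" for i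
  proof (rule metric_CauchyI)
    fix e :: real assume "0 < e"
    then obtain M where M: "\<And>m n. m \<ge> M \<Longrightarrow> n \<ge> M \<Longrightarrow> dist (X m) (X n) < e"
      using metric_CauchyD[OF X] by blast
    have "dist (coord (X m) i) (coord (X n) i) \<le> dist (X m) (X n)" for m n
      using cmod_coord_le_norm[of "X m - X n" i] by (simp add: dist_norm minus_ell2.rep_eq)
    then show "\<exists>M. \<forall>m\<ge>M. \<forall>n\<ge>M. dist (coord (X m) i) (coord (X n) i) < e"
      using M by (meson order_le_less_trans)
  qed
  then have "\<forall>i. \<exists>l. (\<lambda>n. coord (X n) i) \<longlonglongrightarrow> l"
    by (simp add: Cauchy_convergent_iff convergent_def)
  then obtain f where f: "\<And>i. (\<lambda>n. coord (X n) i) \<longlonglongrightarrow> f i"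
    by metis
  have diff: "(\<Sum>i\<in>F. (cmod ((f i - coord (X m) i)))\<^sup>2) \<le> e\<^sup>2"
    if "finite F" "\<And>n. n \<ge> m \<Longrightarrow> dist (X n) (X m) < e" for F m e
  proof (rule LIMSEQ_le_const2)
    show "(\<lambda>n. \<Sum>i\<in>F. (cmod (coord (X n) i - coord (X m) i))\<^sup>2)
        \<longlonglongrightarrow> (\<Sum>i\<in>F. (cmod (f i - coord (X m) i))\<^sup>2)"
      by (intro tendsto_intros f)
    have "(\<Sum>i\<in>F. (cmod (coord (X n) i - coord (X m) i))\<^sup>2) \<le> e\<^sup>2" if "n \<ge> m" for n
    proof -
      have "(\<Sum>i\<in>F. (cmod (coord (X n) i - coord (X m) i))\<^sup>2) \<le> (norm (X n - X m))\<^sup>2"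
        using sum_coord_le_norm[OF \<open>finite F\<close>, of "X n - X m"] by (simp add: minus_ell2.rep_eq)
      also have "\<dots> \<le> e\<^sup>2"
        using \<open>\<And>n. n \<ge> m \<Longrightarrow> dist (X n) (X m) < e\<close>[OF that]
        by (intro power_mono) (auto simp: dist_norm)
      finally show ?thesis .
    qed
    then show "\<exists>N. \<forall>n\<ge>N. (\<Sum>i\<in>F. (cmod (coord (X n) i - coord (X m) i))\<^sup>2) \<le> e\<^sup>2"
      by blast
  qed
  have dist_le: "norm (Abs_ell2 (\<lambda>i. f i - coord (X m) i)) \<le> e"
    "coord (Abs_ell2 (\<lambda>i. f i - coord (X m) i)) = (\<lambda>i. f i - coord (X m) i)"
    if "\<And>n. n \<ge> m \<Longrightarrow> dist (X n) (X m) < e" "0 < e" for m e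
    using Abs_ell2_bound[of "\<lambda>i. f i - coord (X m) i" e] diff[of _ m e] that by auto
  obtain M where M: "\<And>m n. m \<ge> M \<Longrightarrow> n \<ge> M \<Longrightarrow> dist (X m) (X n) < 1"
    using metric_CauchyD[OF X, of 1] by auto
  define L where "L = Abs_ell2 (\<lambda>i. f i - coord (X M) i) + X M"
  have L: "coord L = f"
    using dist_le(2)[of M 1] M unfolding L_def by (simp add: plus_ell2.rep_eq)
  have "X \<longlonglongrightarrow> L"
  proof (rule metric_LIMSEQ_I)
    fix e :: real assume "0 < e"
    then obtain N where N: "\<And>m n. m \<ge> N \<Longrightarrow> n \<ge> N \<Longrightarrow> dist (X m) (X n) < e / 2"
      using metric_CauchyD[OF X, of "e / 2"] by auto
    have "dist (X n) L < e" if "n \<ge> N" for n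
    proof -
      have "norm (Abs_ell2 (\<lambda>i. f i - coord (X n) i)) \<le> e / 2"
        by (rule dist_le(1)) (use N \<open>0 < e\<close> that in auto)
      moreover have "Abs_ell2 (\<lambda>i. f i - coord (X n) i) = L - X n"
      proof -
        have "coord (L - X n) = (\<lambda>i. f i - coord (X n) i)"
          by (simp add: fun_eq_iff minus_ell2.rep_eq L)
        then show ?thesis using coord_inverse[of "L - X n"] by simp
      qed
      ultimately show ?thesis using \<open>0 < e\<close> by (simp add: dist_norm norm_minus_commute)
    qed
    then show "\<exists>N. \<forall>n\<ge>N. dist (X n) L < e" by blast
  qed
  then show "convergent X" by (rule convergentI)
qed

lift_definition ket :: "'i \<Rightarrow> 'i ell2" is "\<lambda>k i. if i = k then 1 else 0"
proof -
  fix k :: 'i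
  have "(\<lambda>i. (cmod (if i = k then 1 else 0))\<^sup>2) summable_on {k}" by simp
  then show "(\<lambda>i. (cmod (if i = k then 1 else 0))\<^sup>2) summable_on UNIV"
    by (rule summable_on_cong_neutral[THEN iffD1, rotated -1]) auto
qed

section \<open>Operators\<close>

type_synonym 'i operator = "'i ell2 \<Rightarrow> 'i ell2"

definition bounded_clinear :: "('i ell2 \<Rightarrow> 'j ell2) \<Rightarrow> bool"
  where "bounded_clinear T \<longleftrightarrow> bounded_linear T \<and> (\<forall>c x. T (c *\<^sub>C x) = c *\<^sub>C T x)"

definition cadj :: "'i operator \<Rightarrow> 'i operator"
  where "cadj T = (THE S. \<forall>x y. cinner (T x) y = cinner x (S y))"

definition commutator :: "'i operator \<Rightarrow> 'i operator \<Rightarrow> 'i operator"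
  where "commutator A B = (\<lambda>x. A (B x) - B (A x))"

definition normal_operator :: "'i operator \<Rightarrow> bool"
  where "normal_operator N \<longleftrightarrow> bounded_clinear N \<and> cadj N \<circ> N = N \<circ> cadj N"

definition isometry :: "('i ell2 \<Rightarrow> 'j ell2) \<Rightarrow> bool"
  where "isometry V \<longleftrightarrow> bounded_clinear V \<and> (\<forall>x. norm (V x) = norm x)"

text \<open>
  \<open>T\<close> is subnormal if it is the restriction of a normal operator \<open>N\<close> on some Hilbert space
  \<open>K\<close> containing the given space \<open>H = \<ell>\<^sup>2(I)\<close>; the inclusion is the isometry \<open>V\<close>.
  HOL cannot quantify existentially over the type of \<open>K\<close>, so \<open>K\<close> is taken to be
  \<open>\<ell>\<^sup>2(I \<times> \<nat>)\<close>. This loses nothing: the closed span of the vectors \<open>N\<^sup>n N*\<^sup>m V x\<close>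
  is reducing for \<open>N\<close> and has Hilbert dimension at most \<open>|I \<times> \<nat>|\<close>, and the restriction of
  \<open>N\<close> to it can be extended by \<open>0\<close> to a space of dimension exactly \<open>|I \<times> \<nat>|\<close>.
\<close>

definition subnormal :: "'i operator \<Rightarrow> bool"
  where "subnormal T \<longleftrightarrow> bounded_clinear T \<and>
    (\<exists>(N :: ('i \<times> nat) operator) (V :: 'i ell2 \<Rightarrow> ('i \<times> nat) ell2).
      normal_operator N \<and> isometry V \<and> (\<forall>x. V (T x) = N (V x)))"

text \<open>
  Positivity on \<open>H\<^sup>n\<close> of the operator matrix whose \<open>(i,j)\<close> entry is \<open>[S\<^sub>j*, S\<^sub>i]\<close>;
  a vector of \<open>H\<^sup>n\<close> is given by the values \<open>x i\<close> for \<open>i < n\<close>.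
\<close>

definition hyponormal_tuple :: "'i operator list \<Rightarrow> bool"
  where "hyponormal_tuple S \<longleftrightarrow> (\<forall>T\<in>set S. bounded_clinear T) \<and>
    (\<forall>x :: nat \<Rightarrow> 'i ell2.
      (\<Sum>i<length S. cinner (\<Sum>j<length S. commutator (cadj (S ! j)) (S ! i) (x j)) (x i))
        \<in> \<real>\<^sub>\<ge>\<^sub>0)"

definition two_hyponormal :: "'i operator \<times> 'i operator \<Rightarrow> bool"
  where "two_hyponormal = (\<lambda>(T1, T2). T1 \<circ> T2 = T2 \<circ> T1 \<and>
    hyponormal_tuple [T1, T2, T1 \<circ> T1, T2 \<circ> T1, T2 \<circ> T2])"

definition H0 :: "('i operator \<times> 'i operator) set"
  where "H0 = {(T1, T2). subnormal T1 \<and> subnormal T2 \<and> T1 \<circ> T2 = T2 \<circ> T1}"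

definition H2 :: "('i operator \<times> 'i operator) set"
  where "H2 = {T \<in> H0. two_hyponormal T}"

section \<open>Two-variable weighted shifts\<close>

definition weighted_translation ::
    "(nat \<times> nat \<Rightarrow> nat \<times> nat) \<Rightarrow> (nat \<times> nat \<Rightarrow> real) \<Rightarrow> (nat \<times> nat) operator"
  where "weighted_translation \<tau> w =
    (THE T. bounded_clinear T \<and> (\<forall>k. T (ket k) = of_real (w k) *\<^sub>C ket (\<tau> k)))"

text \<open>For bounded weights and injective \<open>\<tau>\<close> the description determines a unique operator.\<close>

lemma bounded_clinear_eqI:
  fixes T S :: "'i ell2 \<Rightarrow> 'j ell2"
  assumes T: "bounded_clinear T" and S: "bounded_clinear S" and eq: "\<And>k. T (ket k) = S (ket k)"
  shows "T = S"
proof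
  fix x :: "'i ell2"
  interpret T: bounded_linear T using T by (simp add: bounded_clinear_def)
  interpret S: bounded_linear S using S by (simp add: bounded_clinear_def)
  interpret D: bounded_linear "\<lambda>x. T x - S x"
    by (intro bounded_linear_sub T.bounded_linear_axioms S.bounded_linear_axioms)
  obtain K where K: "0 < K" "\<And>y. norm (T y - S y) \<le> norm y * K"
    using D.pos_bounded by blast
  define p where "p F = (\<Sum>k\<in>F. coord x k *\<^sub>C ket k)" for F
  have coord_p: "coord (p F) i = (if i \<in> F then coord x i else 0)" if "finite F" for F i
    using that unfolding p_def
    by (induction F) (auto simp: zero_ell2.rep_eq plus_ell2.rep_eq scaleC.rep_eq ket.rep_eq)
  have Dp: "T (p F) = S (p F)" for F
    unfolding p_def T.sum S.sum using T S eq by (simp add: bounded_clinear_def)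
  have norm_diff: "(norm (x - p F))\<^sup>2 = (norm x)\<^sup>2 - (\<Sum>k\<in>F. (cmod (coord x k))\<^sup>2)"
    if F: "finite F" for F
  proof -
    have sm: "(\<lambda>k. if k \<in> F then (cmod (coord x k))\<^sup>2 else 0) summable_on UNIV"
      by (rule summable_on_cong_neutral[THEN iffD1, OF _ _ _ summable_on_finite[OF F]]) auto
    have "(norm x)\<^sup>2 = (\<Sum>\<^sub>\<infinity>k. (cmod (coord (x - p F) k))\<^sup>2
        + (if k \<in> F then (cmod (coord x k))\<^sup>2 else 0))"
      unfolding norm_ell2_square
      by (rule infsum_cong) (simp add: minus_ell2.rep_eq coord_p[OF F])
    also have "\<dots> = (norm (x - p F))\<^sup>2 + (\<Sum>\<^sub>\<infinity>k. if k \<in> F then (cmod (coord x k))\<^sup>2 else 0)"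
      unfolding norm_ell2_square by (rule infsum_add[OF coord_summable sm])
    also have "(\<Sum>\<^sub>\<infinity>k. if k \<in> F then (cmod (coord x k))\<^sup>2 else 0) = (\<Sum>\<^sub>\<infinity>k\<in>F. (cmod (coord x k))\<^sup>2)"
      by (rule infsum_cong_neutral) auto
    finally show ?thesis using F by simp
  qed
  have "((\<lambda>F. (\<Sum>k\<in>F. (cmod (coord x k))\<^sup>2)) \<longlongrightarrow> (norm x)\<^sup>2) (finite_subsets_at_top UNIV)"
    using has_sum_infsum[OF coord_summable] unfolding norm_ell2_square has_sum_def .
  then have "((\<lambda>F. K\<^sup>2 * ((norm x)\<^sup>2 - (\<Sum>k\<in>F. (cmod (coord x k))\<^sup>2)))
      \<longlongrightarrow> K\<^sup>2 * ((norm x)\<^sup>2 - (norm x)\<^sup>2)) (finite_subsets_at_top UNIV)"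
    by (intro tendsto_intros)
  moreover have "\<forall>\<^sub>F F in finite_subsets_at_top UNIV.
      (norm (T x - S x))\<^sup>2 \<le> K\<^sup>2 * ((norm x)\<^sup>2 - (\<Sum>k\<in>F. (cmod (coord x k))\<^sup>2))"
  proof (rule eventually_finite_subsets_at_top_weakI)
    fix F :: "'i set" assume F: "finite F"
    have "norm (T x - S x) \<le> norm (x - p F) * K"
      using K(2)[of "x - p F"] by (simp add: T.diff S.diff Dp)
    then have "(norm (T x - S x))\<^sup>2 \<le> (norm (x - p F) * K)\<^sup>2"
      by (intro power_mono) auto
    then show "(norm (T x - S x))\<^sup>2 \<le> K\<^sup>2 * ((norm x)\<^sup>2 - (\<Sum>k\<in>F. (cmod (coord x k))\<^sup>2))"
      by (simp add: power_mult_distrib norm_diff[OF F] mult.commute)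
  qed
  ultimately have "(norm (T x - S x))\<^sup>2 \<le> K\<^sup>2 * ((norm x)\<^sup>2 - (norm x)\<^sup>2)"
    by (rule tendsto_lowerbound) simp
  then show "T x = S x" by simp
qed

lemma ex1_weighted_translation:
  fixes \<tau> :: "nat \<times> nat \<Rightarrow> nat \<times> nat" and w :: "nat \<times> nat \<Rightarrow> real"
  assumes inj: "inj \<tau>" and B: "\<And>k. \<bar>w k\<bar> \<le> B"
  shows "\<exists>!T. bounded_clinear T \<and> (\<forall>k. T (ket k) = of_real (w k) *\<^sub>C ket (\<tau> k))"
proof (rule ex_ex1I)
  define g where "g f k = (if k \<in> range \<tau> then of_real (w (inv \<tau> k)) * coord f (inv \<tau> k) else 0)"
    for f k
  have B0: "0 \<le> B" using B[of undefined] by linarith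
  have bnd: "(\<Sum>k\<in>F. (cmod (g f k))\<^sup>2) \<le> (B * norm f)\<^sup>2" if F: "finite F" for f F
  proof -
    have "(\<Sum>k\<in>F. (cmod (g f k))\<^sup>2) = (\<Sum>k\<in>F \<inter> range \<tau>. (cmod (g f k))\<^sup>2)"
      by (rule sum.mono_neutral_right) (use F in \<open>auto simp: g_def\<close>)
    also have "\<dots> \<le> (\<Sum>k\<in>F \<inter> range \<tau>. B\<^sup>2 * (cmod (coord f (inv \<tau> k)))\<^sup>2)"
    proof (rule sum_mono)
      fix k assume "k \<in> F \<inter> range \<tau>"
      moreover have "\<bar>w (inv \<tau> k)\<bar>\<^sup>2 \<le> B\<^sup>2" by (intro power_mono B) simp
      ultimately show "(cmod (g f k))\<^sup>2 \<le> B\<^sup>2 * (cmod (coord f (inv \<tau> k)))\<^sup>2"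
        by (simp add: g_def norm_mult power_mult_distrib mult_right_mono)
    qed
    also have "\<dots> = B\<^sup>2 * (\<Sum>k\<in>inv \<tau> ` (F \<inter> range \<tau>). (cmod (coord f k))\<^sup>2)"
      by (subst sum.reindex) (auto simp: sum_distrib_left intro: inj_on_inv_into)
    also have "\<dots> \<le> B\<^sup>2 * (norm f)\<^sup>2"
      by (intro mult_left_mono sum_coord_le_norm) (use F in auto)
    finally show ?thesis by (simp add: power_mult_distrib)
  qed
  define T where "T f = Abs_ell2 (g f)" for f
  have T: "coord (T f) = g f" "norm (T f) \<le> B * norm f" for f
    unfolding T_def using Abs_ell2_bound[of "g f" "B * norm f"] bnd[of _ f] B0 by auto
  have "bounded_linear T"
  proof (rule bounded_linear_intro)
    show "T (x + y) = T x + T y" for x y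
      by (rule ell2_eqI) (simp add: T plus_ell2.rep_eq g_def algebra_simps)
    show "T (r *\<^sub>R x) = r *\<^sub>R T x" for r x
      by (rule ell2_eqI) (simp add: T scaleR_ell2_def scaleC.rep_eq g_def)
    show "norm (T x) \<le> norm x * B" for x
      using T(2)[of x] by (simp add: mult.commute)
  qed
  moreover have "T (c *\<^sub>C x) = c *\<^sub>C T x" for c x
    by (rule ell2_eqI) (simp add: T scaleC.rep_eq g_def)
  moreover have "T (ket k) = of_real (w k) *\<^sub>C ket (\<tau> k)" for k
    by (rule ell2_eqI) (auto simp: T scaleC.rep_eq g_def ket.rep_eq inv_f_f[OF inj])
  ultimately show "\<exists>T. bounded_clinear T \<and> (\<forall>k. T (ket k) = of_real (w k) *\<^sub>C ket (\<tau> k))"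
    by (auto simp: bounded_clinear_def)
qed (auto intro: bounded_clinear_eqI)

definition weighted_shift ::
    "(nat \<times> nat \<Rightarrow> real) \<Rightarrow> (nat \<times> nat \<Rightarrow> real) \<Rightarrow> (nat \<times> nat) operator \<times> (nat \<times> nat) operator"
  where "weighted_shift \<alpha> \<beta> =
    (weighted_translation (\<lambda>(i, j). (i + 1, j)) \<alpha>, weighted_translation (\<lambda>(i, j). (i, j + 1)) \<beta>)"

definition op_power ::
    "nat \<Rightarrow> nat \<Rightarrow> 'i operator \<times> 'i operator \<Rightarrow> 'i operator \<times> 'i operator"
  where "op_power h l = (\<lambda>(T1, T2). (T1 ^^ h, T2 ^^ l))"

definition x_wt :: "real \<Rightarrow> nat \<Rightarrow> real"
  where "x_wt \<kappa> n = (if n = 0 then \<kappa> * sqrt (3/4)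
    else sqrt ((real n + 1) * (real n + 3)) / (real n + 2))"

definition alpha_wt :: "real \<Rightarrow> real \<Rightarrow> nat \<times> nat \<Rightarrow> real"
  where "alpha_wt \<kappa> a = (\<lambda>(i, j). if j = 0 then x_wt \<kappa> i else if i = 0 then a else 1)"

definition beta_wt :: "real \<Rightarrow> real \<Rightarrow> nat \<times> nat \<Rightarrow> real"
  where "beta_wt \<kappa> a = (\<lambda>(i, j). if j = 0 then (if i = 0 then \<kappa> else a * \<kappa> / (\<Prod>n<i. x_wt \<kappa> n)) else 1)"

definition W :: "real \<Rightarrow> real \<Rightarrow> (nat \<times> nat) operator \<times> (nat \<times> nat) operator"
  where "W \<kappa> a = weighted_shift (alpha_wt \<kappa> a) (beta_wt \<kappa> a)"

definition h2 :: "real \<Rightarrow> real"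
  where "h2 a = sqrt (9 * (9 - 16 * a\<^sup>2) / (157 - 360 * a\<^sup>2 + 144 * a ^ 4))"

definition h2_21 :: "real \<Rightarrow> real"
  where "h2_21 a = sqrt (225 * (15 - 28 * a\<^sup>2) / (6238 - 15015 * a\<^sup>2 + 6300 * a ^ 4))"

end

theory Submission
  imports Defs
begin

text \<open>
  Subnormality. Each row and column of the shift is a one-variable weighted shift whose Berger
  measure combines point masses at \<open>0\<close> and \<open>1\<close> with Lebesgue measure on \<open>[0,1]\<close>. A normal extension
  is obtained from the zero operator, the bilateral shift and multiplication by \<open>z\<close> on \<open>L\<^sup>2\<close> of the
  unit disk. In the basis of Zernike polynomials the latter has two-term matrix entries, so that
  its normality is an algebraic identity and no function space is needed.

  2-hyponormality. The commutator form splits into forms indexed by \<open>u \<in> \<int>\<^sup>2\<close>, which are Schur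
  complements of the moment matrices \<open>\<gamma> (u + p\<^sub>i + p\<^sub>j)\<close>, with the \<open>p\<^sub>i\<close> the exponents of degree at
  most two. The moments \<open>\<gamma>\<close> come from a measure that is positive except possibly at the origin, so
  only \<open>u = 0\<close> matters. There the condition compares the mass at the origin with the
  minimum of \<open>(1/2 - a\<^sup>2) f(1)\<^sup>2 + \<integral>f\<^sup>2 / 2\<close> over \<open>f(s) = 1 + b s\<^sup>h + c s\<^sup>2\<^sup>h\<close>, where \<open>h = 1\<close> for \<open>W\<close> and
  \<open>h = 2\<close> for its \<open>(2,1)\<close>-power.
\<close>

section \<open>Adjoints on \<open>\<ell>\<^sup>2\<close>\<close>

lemma cinner_commute: "cinner y x = cnj (cinner x y)"
  unfolding cinner_def by (simp flip: infsum_cnj add: mult.commute)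

lemma cinner_add_left: "cinner (x + y) z = cinner x z + cinner y z"
  unfolding cinner_def plus_ell2.rep_eq
  by (simp add: distrib_right infsum_add cinner_summable)

lemma cinner_add_right: "cinner x (y + z) = cinner x y + cinner x z"
  by (metis cinner_add_left cinner_commute complex_cnj_add)

lemma cinner_diff_left: "cinner (x - y) z = cinner x z - cinner y z"
  by (metis add_diff_cancel_right' cinner_add_left diff_add_cancel)

lemma cinner_diff_right: "cinner x (y - z) = cinner x y - cinner x z"
  by (metis add_diff_cancel_right' cinner_add_right diff_add_cancel)

lemma cinner_sum_left: "cinner (sum f A) z = (\<Sum>i\<in>A. cinner (f i) z)"
proof (induction A rule: infinite_finite_induct)
  case empty
  show ?case using cinner_diff_left[of 0 0 z] by simp
qed (use cinner_diff_left[of 0 0 z] in \<open>simp_all add: cinner_add_left\<close>)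

lemma norm_ell2_cinner: "(norm (x :: 'i ell2))\<^sup>2 = Re (cinner x x)"
  by (simp add: norm_ell2_square Re_cinner_self)

definition adjoint_pair :: "('i ell2 \<Rightarrow> 'j ell2) \<Rightarrow> ('j ell2 \<Rightarrow> 'i ell2) \<Rightarrow> bool"
  where "adjoint_pair T S \<longleftrightarrow> (\<forall>x y. cinner (T x) y = cinner x (S y))"

lemma adjoint_pairD: "adjoint_pair T S \<Longrightarrow> cinner (T x) y = cinner x (S y)"
  by (simp add: adjoint_pair_def)

lemma adjoint_pair_sym: "adjoint_pair T S \<Longrightarrow> adjoint_pair S T"
  unfolding adjoint_pair_def by (metis cinner_commute)

lemma adjoint_pair_add:
  "adjoint_pair T S \<Longrightarrow> adjoint_pair T' S' \<Longrightarrow>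
    adjoint_pair (\<lambda>x. T x + T' x) (\<lambda>x. S x + S' x)"
  by (simp add: adjoint_pair_def cinner_add_left cinner_add_right)

lemma adjoint_pair_comp:
  "adjoint_pair T S \<Longrightarrow> adjoint_pair T' S' \<Longrightarrow> adjoint_pair (T \<circ> T') (S' \<circ> S)"
  by (simp add: adjoint_pair_def)

text \<open>\<open>cadj\<close> is a definite description, so exhibiting one adjoint determines it:
  two candidates differ by a vector orthogonal to itself. The adjoints below are given explicitly
  and enter through this lemma.\<close>

lemma cadj_eq:
  assumes "adjoint_pair T S"
  shows "cadj T = S"
  unfolding cadj_def
proof (rule the_equality)
  show "\<forall>x y. cinner (T x) y = cinner x (S y)"
    using assms by (simp add: adjoint_pair_def)
next
  fix R assume R: "\<forall>x y. cinner (T x) y = cinner x (R y)"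
  show "R = S"
  proof
    fix y
    have "cinner (R y - S y) (R y - S y) = 0"
      using R adjoint_pairD[OF assms] by (metis cinner_diff_right diff_self)
    then have "norm (R y - S y) = 0"
      using norm_ell2_cinner[of "R y - S y"] by simp
    then show "R y = S y" by simp
  qed
qed

lemma bounded_clinear_add:
  "bounded_clinear S \<Longrightarrow> bounded_clinear T \<Longrightarrow> bounded_clinear (\<lambda>x. S x + T x)"
  unfolding bounded_clinear_def
  by (auto intro: bounded_linear_add ell2_eqI
      simp: plus_ell2.rep_eq scaleC.rep_eq algebra_simps)

lemma bounded_clinear_comp:
  "bounded_clinear S \<Longrightarrow> bounded_clinear T \<Longrightarrow> bounded_clinear (S \<circ> T)"
  unfolding bounded_clinear_def comp_def by (auto intro: bounded_linear_compose)

section \<open>Weighted composition operators\<close>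

text \<open>Indexed by the target: coordinate \<open>k\<close> of the image reads coordinate
  \<open>\<sigma> k\<close>. A zero weight marks a row without entries, where
  \<open>\<sigma> k\<close> is a dummy value.\<close>

definition wcomp :: "('k \<Rightarrow> real) \<Rightarrow> ('k \<Rightarrow> 'i) \<Rightarrow> 'i ell2 \<Rightarrow> 'k ell2"
  where "wcomp w \<sigma> f = Abs_ell2 (\<lambda>k. of_real (w k) * coord f (\<sigma> k))"

text \<open>The matrix with entries \<open>w k\<close> at \<open>(k, \<sigma> k)\<close> is bounded, and its transpose
  has entries \<open>v i\<close> at \<open>(i, \<tau> i)\<close>.\<close>

definition transposed :: "('k \<Rightarrow> real) \<Rightarrow> ('k \<Rightarrow> 'i) \<Rightarrow> ('i \<Rightarrow> real) \<Rightarrow> ('i \<Rightarrow> 'k) \<Rightarrow> bool"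
  where "transposed w \<sigma> v \<tau> \<longleftrightarrow> (\<exists>B. \<forall>k. \<bar>w k\<bar> \<le> B) \<and>
    (\<forall>k. w k \<noteq> 0 \<longrightarrow> \<tau> (\<sigma> k) = k \<and> v (\<sigma> k) = w k) \<and>
    (\<forall>i. v i \<noteq> 0 \<longrightarrow> \<sigma> (\<tau> i) = i \<and> w (\<tau> i) = v i)"

lemma transposed_sym:
  assumes "transposed w \<sigma> v \<tau>"
  shows "transposed v \<tau> w \<sigma>"
proof -
  obtain B where B: "\<bar>w k\<bar> \<le> B" for k
    using assms unfolding transposed_def by blast
  then have "0 \<le> B" using abs_ge_zero order_trans by blast
  then have "\<bar>v i\<bar> \<le> B" for i
    using assms B unfolding transposed_def by (cases "v i = 0") (simp, metis)
  then show ?thesis using assms unfolding transposed_def by blast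
qed

text \<open>Where \<open>w\<close> is nonzero \<open>\<tau>\<close> inverts \<open>\<sigma>\<close>,
  so no coordinate of \<open>f\<close> is read twice and a bound on the weights bounds the
  operator.\<close>

lemma wcomp_bound:
  assumes "transposed w \<sigma> v \<tau>"
  shows "\<exists>B. \<forall>f. coord (wcomp w \<sigma> f) = (\<lambda>k. of_real (w k) * coord f (\<sigma> k)) \<and>
    norm (wcomp w \<sigma> f) \<le> B * norm f"
proof -
  obtain B where B: "\<bar>w k\<bar> \<le> B" for k
    using assms unfolding transposed_def by blast
  then have B0: "0 \<le> B" using abs_ge_zero order_trans by blast
  have inj: "inj_on \<sigma> {k. w k \<noteq> 0}"
    by (rule inj_on_inverseI[of _ \<tau>]) (use assms in \<open>simp add: transposed_def\<close>)
  have "(\<Sum>k\<in>F. (cmod (of_real (w k) * coord f (\<sigma> k)))\<^sup>2) \<le> (B * norm f)\<^sup>2"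
    if F: "finite F" for f F
  proof -
    have "(\<Sum>k\<in>F. (cmod (of_real (w k) * coord f (\<sigma> k)))\<^sup>2)
        = (\<Sum>k\<in>F \<inter> {k. w k \<noteq> 0}. (cmod (of_real (w k) * coord f (\<sigma> k)))\<^sup>2)"
      by (rule sum.mono_neutral_right) (use F in auto)
    also have "\<dots> \<le> (\<Sum>k\<in>F \<inter> {k. w k \<noteq> 0}. B\<^sup>2 * (cmod (coord f (\<sigma> k)))\<^sup>2)"
    proof (rule sum_mono)
      fix k
      have "\<bar>w k\<bar>\<^sup>2 \<le> B\<^sup>2" by (intro power_mono B) simp
      then show "(cmod (of_real (w k) * coord f (\<sigma> k)))\<^sup>2 \<le> B\<^sup>2 * (cmod (coord f (\<sigma> k)))\<^sup>2"
        by (simp add: norm_mult power_mult_distrib mult_right_mono)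
    qed
    also have "\<dots> = B\<^sup>2 * (\<Sum>k\<in>\<sigma> ` (F \<inter> {k. w k \<noteq> 0}). (cmod (coord f k))\<^sup>2)"
      by (subst sum.reindex) (auto simp: sum_distrib_left intro: inj_on_subset[OF inj])
    also have "\<dots> \<le> B\<^sup>2 * (norm f)\<^sup>2"
      by (intro mult_left_mono sum_coord_le_norm) (use F in auto)
    finally show ?thesis by (simp add: power_mult_distrib)
  qed
  then have "coord (wcomp w \<sigma> f) = (\<lambda>k. of_real (w k) * coord f (\<sigma> k)) \<and>
      norm (wcomp w \<sigma> f) \<le> B * norm f" for f
    unfolding wcomp_def using B0
    using Abs_ell2_bound[of "\<lambda>k. of_real (w k) * coord f (\<sigma> k)" "B * norm f"] by simp
  then show ?thesis by blast
qed

lemma coord_wcomp: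
  "transposed w \<sigma> v \<tau> \<Longrightarrow> coord (wcomp w \<sigma> f) k = of_real (w k) * coord f (\<sigma> k)"
  using wcomp_bound by (metis (no_types, lifting))

lemma bounded_clinear_wcomp:
  assumes "transposed w \<sigma> v \<tau>"
  shows "bounded_clinear (wcomp w \<sigma>)"
proof -
  note coord = coord_wcomp[OF assms]
  obtain B where B: "norm (wcomp w \<sigma> f) \<le> B * norm f" for f
    using wcomp_bound[OF assms] by blast
  have "bounded_linear (wcomp w \<sigma>)"
  proof (rule bounded_linear_intro)
    show "norm (wcomp w \<sigma> x) \<le> norm x * B" for x
      using B[of x] by (simp add: mult.commute)
  qed (rule ell2_eqI; simp add: coord scaleR_ell2_def scaleC.rep_eq plus_ell2.rep_eq algebra_simps)+
  then show ?thesis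
    unfolding bounded_clinear_def by (auto intro!: ell2_eqI simp: coord scaleC.rep_eq)
qed

text \<open>\<open>\<tau>\<close> maps the support of \<open>v\<close> bijectively onto that of
  \<open>w\<close>; reindexing the inner product along it moves the matrix to the other
  side.\<close>

lemma adjoint_pair_wcomp:
  assumes "transposed w \<sigma> v \<tau>"
  shows "adjoint_pair (wcomp w \<sigma>) (wcomp v \<tau>)"
  unfolding adjoint_pair_def
proof (intro allI)
  fix f :: "'b ell2" and g :: "'a ell2"
  have bij: "bij_betw \<tau> {i. v i \<noteq> 0} {k. w k \<noteq> 0}"
    by (rule bij_betwI[of _ _ _ \<sigma>]) (use assms in \<open>auto simp: transposed_def\<close>)
  have "cinner (wcomp w \<sigma> f) g
      = (\<Sum>\<^sub>\<infinity>k\<in>{k. w k \<noteq> 0}. of_real (w k) * coord f (\<sigma> k) * cnj (coord g k))"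
    unfolding cinner_def coord_wcomp[OF assms] by (rule infsum_cong_neutral) auto
  also have "\<dots> = (\<Sum>\<^sub>\<infinity>i\<in>{i. v i \<noteq> 0}.
      of_real (w (\<tau> i)) * coord f (\<sigma> (\<tau> i)) * cnj (coord g (\<tau> i)))"
    by (rule infsum_reindex_bij_betw[OF bij, symmetric])
  also have "\<dots> = cinner f (wcomp v \<tau> g)"
    unfolding cinner_def coord_wcomp[OF transposed_sym[OF assms]]
    by (rule infsum_cong_neutral) (use assms in \<open>auto simp: transposed_def\<close>)
  finally show "cinner (wcomp w \<sigma> f) g = cinner f (wcomp v \<tau> g)" .
qed

lemma weighted_translation_eq_wcomp:
  assumes tr: "transposed w \<sigma> v \<tau>" and left: "\<And>k. \<sigma> (\<tau> k) = k"
    and w: "\<And>k. w (\<tau> k) = v k" and out: "\<And>k. \<tau> (\<sigma> k) \<noteq> k \<Longrightarrow> w k = 0"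
  shows "weighted_translation \<tau> v = wcomp w \<sigma>"
proof -
  obtain B where "\<bar>v k\<bar> \<le> B" for k
    using transposed_sym[OF tr] unfolding transposed_def by blast
  then have ex1: "\<exists>!T. bounded_clinear T \<and> (\<forall>k. T (ket k) = of_real (v k) *\<^sub>C ket (\<tau> k))"
    by (rule ex1_weighted_translation[rotated]) (metis injI left)
  have "wcomp w \<sigma> (ket k) = of_real (v k) *\<^sub>C ket (\<tau> k)" for k
    by (rule ell2_eqI)
      (auto simp: coord_wcomp[OF tr] ket.rep_eq scaleC.rep_eq left w, metis out)
  then show ?thesis
    unfolding weighted_translation_def
    by (intro the1_equality[OF ex1]) (auto intro: bounded_clinear_wcomp[OF tr])
qed

section \<open>Subnormal weighted shifts\<close>

text \<open>Index set of an orthonormal basis on which a normal operator acts: it annihilates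
  \<open>Origin\<close>, is the bilateral shift on the vectors \<open>Circle k\<close>, and is multiplication by \<open>z\<close> on
  \<open>L\<^sup>2\<close> of the unit disk with basis \<open>Disk m n\<close>, the Zernike polynomials with leading term
  proportional to \<open>z\<^sup>m\<close> times the \<open>n\<close>-th power of the conjugate of \<open>z\<close>. The closed span of
  the \<open>Disk m 0\<close> is the Bergman space.\<close>

datatype node = Origin | Circle int | Disk nat nat

instance node :: countable
  by countable_datatype

text \<open>Matrix entry of multiplication by z between normalized Zernike polynomials of degrees
  \<open>s - 1\<close> and \<open>s\<close>. For \<open>m = s\<close> it is the Bergman shift weight
  sqrt (s / (s + 1)).\<close>

definition zern :: "nat \<Rightarrow> nat \<Rightarrow> real"
  where "zern m s = real m / sqrt (real s * (real s + 1))"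

text \<open>On the disk, multiplication by z is the sum of an \<open>up\<close> part, raising the
  exponent of z, and a \<open>down\<close> part, lowering that of its conjugate; primes denote
  transposes. Truncated indices such as \<open>m - 1\<close> at \<open>m = 0\<close> carry weight
  0.\<close>

definition up_wt :: "node \<Rightarrow> real"
  where "up_wt l = (case l of Origin \<Rightarrow> 0 | Circle k \<Rightarrow> 1 | Disk m n \<Rightarrow> zern m (m + n))"

definition up_src :: "node \<Rightarrow> node"
  where "up_src l = (case l of Origin \<Rightarrow> Origin | Circle k \<Rightarrow> Circle (k - 1) | Disk m n \<Rightarrow> Disk (m - 1) n)"

definition up_wt' :: "node \<Rightarrow> real"
  where "up_wt' l = (case l of Origin \<Rightarrow> 0 | Circle k \<Rightarrow> 1 | Disk m n \<Rightarrow> zern (m + 1) (m + n + 1))"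

definition up_src' :: "node \<Rightarrow> node"
  where "up_src' l = (case l of Origin \<Rightarrow> Origin | Circle k \<Rightarrow> Circle (k + 1) | Disk m n \<Rightarrow> Disk (m + 1) n)"

definition down_wt :: "node \<Rightarrow> real"
  where "down_wt l = (case l of Disk m n \<Rightarrow> zern (n + 1) (m + n + 1) | _ \<Rightarrow> 0)"

definition down_src :: "node \<Rightarrow> node"
  where "down_src l = (case l of Disk m n \<Rightarrow> Disk m (n + 1) | _ \<Rightarrow> l)"

definition down_wt' :: "node \<Rightarrow> real"
  where "down_wt' l = (case l of Disk m n \<Rightarrow> zern n (m + n) | _ \<Rightarrow> 0)"

definition down_src' :: "node \<Rightarrow> node"
  where "down_src' l = (case l of Disk m n \<Rightarrow> Disk m (n - 1) | _ \<Rightarrow> l)"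

lemmas node_defs = up_wt_def up_wt'_def up_src_def up_src'_def
  down_wt_def down_wt'_def down_src_def down_src'_def

lemma zern_0 [simp]: "zern 0 s = 0"
  by (simp add: zern_def)

lemma zern_bound: "m \<le> s \<Longrightarrow> \<bar>zern m s\<bar> \<le> 1"
proof -
  assume "m \<le> s"
  then have "real m \<le> sqrt (real s * real s)" by simp
  also have "\<dots> \<le> sqrt (real s * (real s + 1))"
    by (intro real_sqrt_le_mono mult_left_mono) auto
  finally show ?thesis
    by (cases "s = 0") (auto simp: zern_def divide_simps)
qed

lemma transposed_up: "transposed up_wt up_src up_wt' up_src'"
  unfolding transposed_def
proof (intro conjI allI exI[of _ 1])
  fix l
  show "\<bar>up_wt l\<bar> \<le> 1"
    by (cases l) (auto simp: up_wt_def intro: zern_bound)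
  show "up_wt l \<noteq> 0 \<longrightarrow> up_src' (up_src l) = l \<and> up_wt' (up_src l) = up_wt l"
  proof (cases l)
    case (Disk m n)
    then show ?thesis by (cases m) (auto simp: node_defs)
  qed (auto simp: node_defs)
  show "up_wt' l \<noteq> 0 \<longrightarrow> up_src (up_src' l) = l \<and> up_wt (up_src' l) = up_wt' l"
    by (cases l) (auto simp: node_defs)
qed

lemma transposed_down: "transposed down_wt down_src down_wt' down_src'"
  unfolding transposed_def
proof (intro conjI allI exI[of _ 1])
  fix l
  show "\<bar>down_wt l\<bar> \<le> 1"
    by (cases l) (auto simp: down_wt_def intro: zern_bound)
  show "down_wt' l \<noteq> 0 \<longrightarrow> down_src (down_src' l) = l \<and> down_wt (down_src' l) = down_wt' l"
  proof (cases l)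
    case (Disk m n)
    then show ?thesis by (cases n) (auto simp: node_defs)
  qed (auto simp: node_defs)
  show "down_wt l \<noteq> 0 \<longrightarrow> down_src' (down_src l) = l \<and> down_wt' (down_src l) = down_wt l"
    by (cases l) (auto simp: node_defs)
qed

lemma transposed_lines:
  assumes "transposed w \<sigma> v \<tau>"
  shows "transposed (\<lambda>(j, l). w l) (\<lambda>(j, l). (j, \<sigma> l)) (\<lambda>(j, l). v l) (\<lambda>(j, l). (j, \<tau> l))"
  using assms unfolding transposed_def by (auto; metis)

section \<open>The normal model operator\<close>

definition up :: "(nat \<times> node) operator"
  where "up = wcomp (\<lambda>(j, l). up_wt l) (\<lambda>(j, l). (j, up_src l))"
definition up' :: "(nat \<times> node) operator"
  where "up' = wcomp (\<lambda>(j, l). up_wt' l) (\<lambda>(j, l). (j, up_src' l))"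
definition down :: "(nat \<times> node) operator"
  where "down = wcomp (\<lambda>(j, l). down_wt l) (\<lambda>(j, l). (j, down_src l))"
definition down' :: "(nat \<times> node) operator"
  where "down' = wcomp (\<lambda>(j, l). down_wt' l) (\<lambda>(j, l). (j, down_src' l))"

lemmas transposed_up_lines = transposed_lines[OF transposed_up]
lemmas transposed_down_lines = transposed_lines[OF transposed_down]

lemma coord_up_down:
  "coord (up f) (j, l) = of_real (up_wt l) * coord f (j, up_src l)"
  "coord (up' f) (j, l) = of_real (up_wt' l) * coord f (j, up_src' l)"
  "coord (down f) (j, l) = of_real (down_wt l) * coord f (j, down_src l)"
  "coord (down' f) (j, l) = of_real (down_wt' l) * coord f (j, down_src' l)"
  unfolding up_def up'_def down_def down'_def
  by (simp_all add: coord_wcomp[OF transposed_up_lines] coord_wcomp[OF transposed_down_lines]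
      coord_wcomp[OF transposed_up_lines[THEN transposed_sym]]
      coord_wcomp[OF transposed_down_lines[THEN transposed_sym]])

definition model :: "(nat \<times> node) operator"
  where "model f = up f + down f"
definition model' :: "(nat \<times> node) operator"
  where "model' f = up' f + down' f"

lemma bounded_clinear_model: "bounded_clinear model"
  unfolding model_def [abs_def] up_def down_def
  by (intro bounded_clinear_add bounded_clinear_wcomp[OF transposed_up_lines]
      bounded_clinear_wcomp[OF transposed_down_lines])

lemma adjoint_pair_model: "adjoint_pair model model'"
  unfolding model_def [abs_def] model'_def [abs_def] up_def down_def up'_def down'_def
  by (intro adjoint_pair_add adjoint_pair_wcomp[OF transposed_up_lines]
      adjoint_pair_wcomp[OF transposed_down_lines])

lemma coord_model:
  "coord (model f) (j, Origin) = 0"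
  "coord (model f) (j, Circle k) = coord f (j, Circle (k - 1))"
  "coord (model f) (j, Disk m n) = of_real (zern m (m + n)) * coord f (j, Disk (m - 1) n)
    + of_real (zern (n + 1) (m + n + 1)) * coord f (j, Disk m (n + 1))"
  by (simp_all add: model_def plus_ell2.rep_eq coord_up_down node_defs)

lemma coord_model':
  "coord (model' f) (j, Origin) = 0"
  "coord (model' f) (j, Circle k) = coord f (j, Circle (k + 1))"
  "coord (model' f) (j, Disk m n) = of_real (zern (m + 1) (m + n + 1)) * coord f (j, Disk (m + 1) n)
    + of_real (zern n (m + n)) * coord f (j, Disk m (n - 1))"
  by (simp_all add: model'_def plus_ell2.rep_eq coord_up_down node_defs)

lemma zern_square: "zern m s * zern m s = (real m)\<^sup>2 / (real s * (real s + 1))"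
  by (simp add: zern_def power2_eq_square flip: real_sqrt_mult)

text \<open>These are the diagonal entries of \<open>model \<circ> model'\<close> and
  \<open>model' \<circ> model\<close>. After regrouping by degree, the differences of squares on
  both sides collapse to (m - n) / (m + n + 1).\<close>

lemma zern_identity:
  "zern m (m+n) * zern m (m+n) + zern (n+1) (m+n+1) * zern (n+1) (m+n+1)
    = zern (m+1) (m+n+1) * zern (m+1) (m+n+1) + zern n (m+n) * zern n (m+n)"
proof (cases "m + n = 0")
  case False
  define x y where xy: "x = real m" "y = real n"
  have p: "x + y > 0" using False unfolding xy by linarith
  have "x\<^sup>2 / ((x + y) * (x + y + 1)) - y\<^sup>2 / ((x + y) * (x + y + 1))
      = ((x + y) * (x - y)) / ((x + y) * (x + y + 1))"
    by (simp add: power2_eq_square algebra_simps flip: diff_divide_distrib)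
  also have "\<dots> = (x - y) / (x + y + 1)" using p by simp
  finally have 1: "x\<^sup>2 / ((x + y) * (x + y + 1)) - y\<^sup>2 / ((x + y) * (x + y + 1))
      = (x - y) / (x + y + 1)" .
  have "(x + 1)\<^sup>2 / ((x + y + 1) * (x + y + 1 + 1)) - (y + 1)\<^sup>2 / ((x + y + 1) * (x + y + 1 + 1))
      = ((x - y) * (x + y + 1 + 1)) / ((x + y + 1) * (x + y + 1 + 1))"
    by (simp add: power2_eq_square algebra_simps flip: diff_divide_distrib)
  also have "\<dots> = (x - y) / (x + y + 1)" using p by simp
  finally show ?thesis using 1
    unfolding zern_square of_nat_add of_nat_1 xy[symmetric] by linarith
qed simp

lemma model_normal: "model \<circ> model' = model' \<circ> model"
proof
  fix f
  show "(model \<circ> model') f = (model' \<circ> model) f"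
  proof (rule ell2_eqI)
    fix k :: "nat \<times> node"
    obtain j l where k: "k = (j, l)" by (cases k)
    show "coord ((model \<circ> model') f) k = coord ((model' \<circ> model) f) k"
    proof (cases l)
      case (Disk m n)
      define c where "c i s = complex_of_real (zern i s)" for i s
      have "c m (m+n) * c m (m+n) + c (n+1) (m+n+1) * c (n+1) (m+n+1)
          = c (m+1) (m+n+1) * c (m+1) (m+n+1) + c n (m+n) * c n (m+n)"
        unfolding c_def using zern_identity[of m n] by (simp flip: of_real_mult of_real_add)
      then have diag: "(c m (m+n) * c m (m+n) + c (n+1) (m+n+1) * c (n+1) (m+n+1)) * z
          = (c (m+1) (m+n+1) * c (m+1) (m+n+1) + c n (m+n) * c n (m+n)) * z" for z
        by simp
      \<comment> \<open>The denominator of \<open>zern\<close> depends only on the degree, so both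
        routes from \<open>Disk (m - 1) (n - 1)\<close> to \<open>Disk m n\<close> have equal
        weight. If \<open>m = 0\<close> or \<open>n = 0\<close> the truncated indices do no harm, as
        both sides vanish.\<close>
      have low: "c m (m+n) * (c n (m-1+n) * z) = c n (m+n) * (c m (m+(n-1)) * z)" for z
        by (cases m; cases n) (simp_all add: c_def zern_def)
      have high: "c (n+1) (m+n+1) * (c (m+1) (m+(n+1)+1) * z)
          = c (m+1) (m+n+1) * (c (n+1) (m+1+n+1) * z)" for z
        by (simp add: c_def zern_def)
      have L: "coord ((model \<circ> model') f) k =
          (c m (m+n) * c m (m+n) + c (n+1) (m+n+1) * c (n+1) (m+n+1)) * coord f (j, Disk m n)
          + c m (m+n) * (c n (m-1+n) * coord f (j, Disk (m - 1) (n - 1)))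
          + c (n+1) (m+n+1) * (c (m+1) (m+(n+1)+1) * coord f (j, Disk (m + 1) (n + 1)))"
        by (cases m) (simp_all add: k Disk coord_model coord_model' c_def algebra_simps)
      have R: "coord ((model' \<circ> model) f) k =
          (c (m+1) (m+n+1) * c (m+1) (m+n+1) + c n (m+n) * c n (m+n)) * coord f (j, Disk m n)
          + c n (m+n) * (c m (m+(n-1)) * coord f (j, Disk (m - 1) (n - 1)))
          + c (m+1) (m+n+1) * (c (n+1) (m+1+n+1) * coord f (j, Disk (m + 1) (n + 1)))"
        by (cases n) (simp_all add: k Disk coord_model coord_model' c_def algebra_simps)
      show ?thesis unfolding L R diag low high ..
    qed (simp_all add: k coord_model coord_model')
  qed
qed

text \<open>The adjoint is given explicitly, so that the hypotheses pass to \<open>T \<circ> T\<close> and \<open>N \<circ> N\<close>.\<close>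

lemma subnormalI:
  fixes T :: "'i::countable operator" and N N' :: "'k::countable operator"
  assumes T: "bounded_clinear T"
    and N: "bounded_clinear N" "adjoint_pair N N'" "N \<circ> N' = N' \<circ> N"
    and V: "isometry V" and ext: "\<And>x. V (T x) = N (V x)"
    and inf: "infinite (UNIV :: 'k set)"
  shows "subnormal T"
proof -
  \<comment> \<open>\<open>subnormal\<close> prescribes the index set of the larger space; a
    bijection of countably infinite sets induces a unitary \<open>R\<close> that transports the
    extension there.\<close>
  have "infinite (UNIV :: ('i \<times> nat) set)"
    by (simp add: finite_prod)
  then have "bij_betw (from_nat_into (UNIV :: ('i \<times> nat) set) \<circ> to_nat_on (UNIV :: 'k set)) UNIV UNIV"
    using inf by (intro bij_betw_trans[of _ _ "UNIV :: nat set"] to_nat_on_infinite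
        bij_betw_from_nat_into) auto
  then obtain h :: "'k \<Rightarrow> 'i \<times> nat" where h: "bij h" by blast
  define R where "R = wcomp (\<lambda>_. 1) (inv h)"
  define R' where "R' = wcomp (\<lambda>_. 1) h"
  have tr: "transposed (\<lambda>_. 1) (inv h) (\<lambda>_. 1) h"
    using h by (auto simp: transposed_def bij_is_inj bij_is_surj surj_f_inv_f intro!: exI[of _ 1])
  have R: "bounded_clinear R" "bounded_clinear R'" "adjoint_pair R R'" "adjoint_pair R' R"
    unfolding R_def R'_def using tr
    by (auto intro: bounded_clinear_wcomp adjoint_pair_wcomp transposed_sym)
  have R'R: "R' (R x) = x" for x
    unfolding R_def R'_def using h
    by (intro ell2_eqI) (simp add: coord_wcomp[OF tr] coord_wcomp[OF transposed_sym[OF tr]]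
        bij_is_inj)
  have adj: "adjoint_pair (R \<circ> (N \<circ> R')) (R \<circ> (N' \<circ> R'))"
    using adjoint_pair_comp[OF R(3) adjoint_pair_comp[OF N(2) R(4)]] by (simp add: comp_assoc)
  have "N (N' x) = N' (N x)" for x using N(3) by (metis comp_apply)
  then have "normal_operator (R \<circ> (N \<circ> R'))"
    unfolding normal_operator_def cadj_eq[OF adj]
    using R N by (auto intro!: bounded_clinear_comp simp: fun_eq_iff R'R)
  moreover have "isometry (R \<circ> V)"
  proof -
    have "norm (R x) = norm x" for x
    proof -
      have "(norm (R x))\<^sup>2 = (norm x)\<^sup>2"
        unfolding norm_ell2_cinner using adjoint_pairD[OF R(3)] by (simp add: R'R)
      then show ?thesis by simp
    qed
    then show ?thesis using V R by (auto simp: isometry_def intro: bounded_clinear_comp)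
  qed
  moreover have "(R \<circ> V) (T x) = (R \<circ> (N \<circ> R')) ((R \<circ> V) x)" for x
    by (simp add: R'R ext)
  ultimately show ?thesis using T unfolding subnormal_def by blast
qed

text \<open>The sequence \<open>f (e (0, j)), f (e (1, j)), \<dots>\<close> is one of the one-variable shifts of which
  \<open>T\<close> is the direct sum. Its Berger measure is a combination of the point masses at \<open>0\<close> and \<open>1\<close>
  and of Lebesgue measure on \<open>[0,1]\<close>; \<open>p\<close>, \<open>q\<close>, \<open>r\<close> are the corresponding components
  of the embedding.\<close>

lemma shift_subnormal:
  fixes T :: "(nat \<times> nat) operator" and e :: "nat \<times> nat \<Rightarrow> nat \<times> nat"
    and p :: "nat \<Rightarrow> real" and q r w :: "nat \<Rightarrow> nat \<Rightarrow> real"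
  assumes T: "bounded_clinear T" and e: "\<And>k. e (e k) = k"
    and T0: "\<And>f j. coord (T f) (e (0, j)) = 0"
    and TSuc: "\<And>f i j. coord (T f) (e (Suc i, j)) = of_real (w i j) * coord f (e (i, j))"
    and one: "\<And>i j. (if i = 0 then (p j)\<^sup>2 else 0) + (q i j)\<^sup>2 + (r i j)\<^sup>2 = 1"
    and q: "\<And>i j. q (Suc i) j * w i j = q i j"
    and r: "\<And>i j. r (Suc i) j * w i j = sqrt ((real i + 1) / (real i + 2)) * r i j"
  shows "subnormal T" "subnormal (T \<circ> T)"
proof -
  \<comment> \<open>\<open>e\<close> will be the identity for rows and the swap for columns;
    \<open>line\<close> selects a one-variable shift and \<open>pos\<close> the position along
    it.\<close>
  define pos line where pl: "pos k = fst (e k)" "line k = snd (e k)" for k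
  have pl_e: "pos (e (i, j)) = i" "line (e (i, j)) = j" "e (pos k, line k) = k" for i j k
    by (simp_all add: pl e)
  have bnd: "\<bar>q i j\<bar> \<le> 1" "\<bar>r i j\<bar> \<le> 1" "\<bar>p j\<bar> \<le> 1" for i j
    using one[of i j] one[of 0 j] zero_le_power2[of "p j"] zero_le_power2[of "q i j"]
      zero_le_power2[of "r i j"] zero_le_power2[of "q 0 j"] zero_le_power2[of "r 0 j"]
    unfolding abs_square_le_1[symmetric] by (smt (verit, ccfv_threshold))+
  \<comment> \<open>The basis vector at position \<open>i\<close> of line \<open>j\<close> goes to
    \<open>q i j\<close> times \<open>Circle i\<close> plus \<open>r i j\<close> times
    \<open>Disk i 0\<close>, plus \<open>p j\<close> times \<open>Origin\<close> if
    \<open>i = 0\<close>, all on line \<open>j\<close>. By \<open>one\<close> the image has norm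
    1.\<close>
  define wp sp wp' sp' where P:
    "wp = (\<lambda>(j, l). case l of Origin \<Rightarrow> p j | _ \<Rightarrow> 0)"
    "sp = (\<lambda>(j :: nat, l :: node). e (0, j))"
    "wp' k = (if pos k = 0 then p (line k) else 0)"
    "sp' k = (line k, Origin)" for k
  define wq sq wq' sq' where Q:
    "wq = (\<lambda>(j, l). case l of Circle i \<Rightarrow> if i < 0 then 0 else q (nat i) j | _ \<Rightarrow> 0)"
    "sq = (\<lambda>(j, l). e (case l of Circle i \<Rightarrow> nat i | _ \<Rightarrow> 0, j))"
    "wq' k = q (pos k) (line k)"
    "sq' k = (line k, Circle (int (pos k)))" for k
  define wr sr wr' sr' where R:
    "wr = (\<lambda>(j, l). case l of Disk i n \<Rightarrow> if n = 0 then r i j else 0 | _ \<Rightarrow> 0)"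
    "sr = (\<lambda>(j, l). e (case l of Disk i n \<Rightarrow> i | _ \<Rightarrow> 0, j))"
    "wr' k = r (pos k) (line k)"
    "sr' k = (line k, Disk (pos k) 0)" for k
  have tp: "transposed wp sp wp' sp'"
    by (auto simp: transposed_def P pl_e bnd split: node.splits intro!: exI[of _ 1]) (metis pl_e(3))
  have tq: "transposed wq sq wq' sq'"
    by (auto simp: transposed_def Q pl_e bnd split: node.splits intro!: exI[of _ 1])
  have tr: "transposed wr sr wr' sr'"
    by (auto simp: transposed_def R pl_e bnd split: node.splits intro!: exI[of _ 1])
  note coords = coord_wcomp[OF tp] coord_wcomp[OF tq] coord_wcomp[OF tr]
    coord_wcomp[OF tp[THEN transposed_sym]] coord_wcomp[OF tq[THEN transposed_sym]]
    coord_wcomp[OF tr[THEN transposed_sym]]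
  define V where "V f = wcomp wp sp f + (wcomp wq sq f + wcomp wr sr f)" for f
  define V' where "V' f = wcomp wp' sp' f + (wcomp wq' sq' f + wcomp wr' sr' f)" for f
  have V: "bounded_clinear V" "adjoint_pair V V'"
    unfolding V_def [abs_def] V'_def [abs_def]
    by (intro bounded_clinear_add bounded_clinear_wcomp[OF tp] bounded_clinear_wcomp[OF tq]
        bounded_clinear_wcomp[OF tr] adjoint_pair_add adjoint_pair_wcomp[OF tp]
        adjoint_pair_wcomp[OF tq] adjoint_pair_wcomp[OF tr])+
  have coord_V: "coord (V f) (j, Origin) = of_real (p j) * coord f (e (0, j))"
    "coord (V f) (j, Circle i) = (if i < 0 then 0 else of_real (q (nat i) j) * coord f (e (nat i, j)))"
    "coord (V f) (j, Disk m n) = (if n = 0 then of_real (r m j) * coord f (e (m, j)) else 0)"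
    for f i j m n
    unfolding V_def plus_ell2.rep_eq coords by (simp_all add: P Q R)
  have "V' (V f) = f" for f
  proof (rule ell2_eqI)
    fix k
    define i j where ij: "i = pos k" "j = line k"
    have k: "k = e (i, j)" by (simp add: ij pl_e)
    have "coord (V' (V f)) k
        = of_real ((if i = 0 then (p j)\<^sup>2 else 0) + (q i j)\<^sup>2 + (r i j)\<^sup>2) * coord f k"
      unfolding k V'_def plus_ell2.rep_eq coords
      by (simp add: P(3,4) Q(3,4) R(3,4) coord_V pl_e power2_eq_square algebra_simps)
    then show "coord (V' (V f)) k = coord f k" unfolding one by simp
  qed
  then have "(norm (V f))\<^sup>2 = (norm f)\<^sup>2" for f
    unfolding norm_ell2_cinner using adjoint_pairD[OF V(2)] by simp
  then have iso: "isometry V"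
    using V(1) by (simp add: isometry_def)
  have ext: "V (T f) = model (V f)" for f
  proof (rule ell2_eqI)
    fix k :: "nat \<times> node"
    obtain j l where k: "k = (j, l)" by (cases k)
    show "coord (V (T f)) k = coord (model (V f)) k"
    proof (cases l)
      case Origin
      then show ?thesis by (simp add: k coord_V coord_model T0)
    next
      case (Circle i)
      show ?thesis
      proof (cases "i \<le> 0")
        case True
        then show ?thesis by (auto simp: Circle k coord_V coord_model T0)
      next
        case False
        then obtain m where m: "i = int (Suc m)"
          by (metis gr0_implies_Suc not_le zero_less_imp_eq_int)
        have "of_real (q (Suc m) j * w m j) = complex_of_real (q m j)" by (simp add: q)
        then show ?thesis
          by (simp add: Circle k coord_V coord_model TSuc m nat_add_distrib flip: mult.assoc)
      qed
    next
      case (Disk m n)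
      show ?thesis
      proof (cases m)
        case 0
        then show ?thesis by (simp add: Disk k coord_V coord_model T0)
      next
        case (Suc i)
        \<comment> \<open>On the vectors \<open>Disk m 0\<close> the model is the Bergman shift,
          whose weights occur in hypothesis \<open>r\<close>.\<close>
        have "zern (Suc i) (Suc i) = (real i + 1) / sqrt (real i + 1) / sqrt (real i + 2)"
          by (simp add: zern_def real_sqrt_mult add.commute)
        also have "\<dots> = sqrt ((real i + 1) / (real i + 2))"
          by (simp add: real_div_sqrt real_sqrt_divide)
        finally have "zern (Suc i) (Suc i) = sqrt ((real i + 1) / (real i + 2))" .
        then have "of_real (r (Suc i) j * w i j) = complex_of_real (zern (Suc i) (Suc i) * r i j)"
          by (simp add: r)
        then show ?thesis
          by (simp add: Disk Suc k coord_V coord_model TSuc flip: mult.assoc)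
      qed
    qed
  qed
  have inf: "infinite (UNIV :: (nat \<times> node) set)"
    using UNIV_not_singleton by (simp add: finite_prod)
  show "subnormal T"
    by (rule subnormalI[OF T bounded_clinear_model adjoint_pair_model model_normal iso ext inf])
  have nn: "model (model' x) = model' (model x)" for x
    using model_normal by (metis comp_apply)
  show "subnormal (T \<circ> T)"
    by (rule subnormalI[OF bounded_clinear_comp[OF T T]
          bounded_clinear_comp[OF bounded_clinear_model bounded_clinear_model]
          adjoint_pair_comp[OF adjoint_pair_model adjoint_pair_model] _ iso _ inf])
      (auto simp: fun_eq_iff nn ext)
qed

section \<open>Hyponormality of tuples of moment shifts\<close>

text \<open>Extension by zero to the integer lattice makes index translations bijective, so sums can
  be reindexed without boundary terms.\<close>

definition zext :: "(nat \<times> nat) ell2 \<Rightarrow> int \<times> int \<Rightarrow> complex"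
  where "zext f k = (if 0 \<le> fst k \<and> 0 \<le> snd k then coord f (nat (fst k), nat (snd k)) else 0)"

lemma bij_betw_quadrant:
  "bij_betw (map_prod int int) UNIV {k :: int \<times> int. 0 \<le> fst k \<and> 0 \<le> snd k}"
  by (rule bij_betwI[of _ _ _ "map_prod nat nat"]) auto

lemma has_sum_zext: "((\<lambda>k. zext f k * cnj (zext g k)) has_sum cinner f g) UNIV"
proof -
  have "((\<lambda>i. coord f i * cnj (coord g i)) has_sum cinner f g) UNIV"
    unfolding cinner_def by (rule has_sum_infsum[OF cinner_summable])
  then have "((\<lambda>i. zext f (map_prod int int i) * cnj (zext g (map_prod int int i))) has_sum cinner f g) UNIV"
    by (simp add: zext_def split_beta)
  then have "((\<lambda>k. zext f k * cnj (zext g k)) has_sum cinner f g) {k. 0 \<le> fst k \<and> 0 \<le> snd k}"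
    by (subst (asm) has_sum_reindex_bij_betw[OF bij_betw_quadrant])
  then show ?thesis
    by (rule has_sum_cong_neutral[THEN iffD1, rotated -1]) (auto simp: zext_def)
qed

text \<open>\<open>S\<close> is \<open>T\<^sup>p\<close> for the pair of shifts with \<open>\<parallel>T\<^sup>k e\<^sub>0\<parallel>\<^sup>2 = \<gamma> k\<close>. The values of \<open>\<gamma>\<close> outside the
  quadrant are irrelevant.\<close>

definition moment_shift ::
    "(int \<times> int \<Rightarrow> real) \<Rightarrow> int \<times> int \<Rightarrow> (nat \<times> nat) operator \<Rightarrow> (nat \<times> nat) operator \<Rightarrow> bool"
  where "moment_shift \<gamma> p S S' \<longleftrightarrow> bounded_clinear S \<and> adjoint_pair S S' \<and>
    0 \<le> fst p \<and> 0 \<le> snd p \<and>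
    (\<forall>f k. zext (S f) k = of_real (sqrt (\<gamma> k / \<gamma> (k - p))) * zext f (k - p)) \<and>
    (\<forall>f k. zext (S' f) k = (if 0 \<le> fst k \<and> 0 \<le> snd k
      then of_real (sqrt (\<gamma> (k + p) / \<gamma> k)) * zext f (k + p) else 0))"

text \<open>The weights are quotients of a single function and telescope.\<close>

lemma moment_shift_comp:
  assumes pos: "\<And>k. 0 < \<gamma> k" and S: "moment_shift \<gamma> p S S'" and R: "moment_shift \<gamma> q R R'"
  shows "moment_shift \<gamma> (p + q) (S \<circ> R) (R' \<circ> S')"
proof -
  have mult: "sqrt (\<gamma> k / \<gamma> l) * sqrt (\<gamma> l / \<gamma> m) = sqrt (\<gamma> k / \<gamma> m)" for k l m
    using pos[of l] by (simp flip: real_sqrt_mult)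
  have multc: "complex_of_real (sqrt (\<gamma> k / \<gamma> l)) * (of_real (sqrt (\<gamma> l / \<gamma> m)) * z)
      = of_real (sqrt (\<gamma> k / \<gamma> m)) * z"
    "complex_of_real (sqrt (\<gamma> l / \<gamma> m)) * (of_real (sqrt (\<gamma> k / \<gamma> l)) * z)
      = of_real (sqrt (\<gamma> k / \<gamma> m)) * z" for k l m z
    unfolding mult[of k l m, symmetric] of_real_mult by (simp_all only: mult_ac)
  have SR: "zext ((S \<circ> R) f) k = of_real (sqrt (\<gamma> k / \<gamma> (k - (p + q)))) * zext f (k - (p + q))" for f k
  proof -
    have "zext ((S \<circ> R) f) k = of_real (sqrt (\<gamma> k / \<gamma> (k - p)))
        * (of_real (sqrt (\<gamma> (k - p) / \<gamma> (k - p - q))) * zext f (k - p - q))"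
      using S R unfolding moment_shift_def comp_apply by metis
    then show ?thesis unfolding multc diff_diff_eq .
  qed
  have RS: "zext ((R' \<circ> S') f) k = (if 0 \<le> fst k \<and> 0 \<le> snd k
      then of_real (sqrt (\<gamma> (k + (p + q)) / \<gamma> k)) * zext f (k + (p + q)) else 0)" for f k
  proof (cases "0 \<le> fst k \<and> 0 \<le> snd k")
    case True
    then have "0 \<le> fst (k + q) \<and> 0 \<le> snd (k + q)"
      using R by (simp add: moment_shift_def)
    then have "zext ((R' \<circ> S') f) k = of_real (sqrt (\<gamma> (k + q) / \<gamma> k))
        * (of_real (sqrt (\<gamma> (k + q + p) / \<gamma> (k + q))) * zext f (k + q + p))"
      using True S R unfolding moment_shift_def comp_apply by metis
    then show ?thesis using True unfolding multc by (simp add: add_ac)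
  next
    case False
    then show ?thesis by (auto simp: zext_def)
  qed
  show ?thesis
    unfolding moment_shift_def
    by (intro conjI allI SR RS bounded_clinear_comp adjoint_pair_comp)
      (use S R in \<open>simp_all add: moment_shift_def\<close>)
qed

text \<open>For \<open>u\<close> in the quadrant, this is the Schur complement in the moment matrix at \<open>u\<close> of the row
  belonging to the exponent \<open>0\<close>.\<close>

definition deficit :: "(int \<times> int \<Rightarrow> real) \<Rightarrow> (nat \<Rightarrow> int \<times> int) \<Rightarrow> nat \<Rightarrow> int \<times> int \<Rightarrow> (nat \<Rightarrow> real) \<Rightarrow> real"
  where "deficit \<gamma> p n u z = (\<Sum>i<n. \<Sum>j<n. \<gamma> (u + p i + p j) * z i * z j)
    - (if 0 \<le> fst u \<and> 0 \<le> snd u then (\<Sum>j<n. \<gamma> (u + p j) * z j)\<^sup>2 / \<gamma> u else 0)"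

text \<open>Dividing by the root turns shift weights into moments; a common \<open>u\<close> groups
  the coordinates of the various \<open>x j\<close> that the commutators couple.\<close>

definition normalized ::
    "(int \<times> int \<Rightarrow> real) \<Rightarrow> (nat \<Rightarrow> int \<times> int) \<Rightarrow> (nat \<Rightarrow> (nat \<times> nat) ell2) \<Rightarrow> int \<times> int \<Rightarrow> nat \<Rightarrow> complex"
  where "normalized \<gamma> p x u j = zext (x j) (u + p j) / of_real (sqrt (\<gamma> (u + p j)))"

lemma bij_translate: "bij (\<lambda>u :: int \<times> int. u + c)"
  by (rule bij_betwI[of _ _ _ "\<lambda>u. u - c"]) auto

text \<open>The entry is the inner product of \<open>S (x j)\<close> with \<open>R (x i)\<close>
  minus that of \<open>R' (x j)\<close> with \<open>S' (x i)\<close>. Summed over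
  \<open>u + p i + p j\<close> and over \<open>u\<close> respectively, both involve only
  \<open>x j\<close> at \<open>u + p j\<close> and \<open>x i\<close> at \<open>u + p i\<close>. The
  second sum lives on the quadrant, hence the conditional.\<close>

lemma has_sum_commutator_entry:
  assumes pos: "\<And>k. 0 < \<gamma> k"
    and i: "moment_shift \<gamma> (p i) S S'" and j: "moment_shift \<gamma> (p j) R R'"
  shows "((\<lambda>u. of_real (\<gamma> (u + p i + p j) - (if 0 \<le> fst u \<and> 0 \<le> snd u
        then \<gamma> (u + p i) * \<gamma> (u + p j) / \<gamma> u else 0))
      * (normalized \<gamma> p x u j * cnj (normalized \<gamma> p x u i)))
    has_sum cinner (commutator (cadj R) S (x j)) (x i)) UNIV"
proof -
  define Z where "Z = normalized \<gamma> p x"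
  note S = i[unfolded moment_shift_def] and R = j[unfolded moment_shift_def]
  have adj: "adjoint_pair S S'" "adjoint_pair R R'" using S R by blast+
  have zext: "zext (S f) k = of_real (sqrt (\<gamma> k / \<gamma> (k - p i))) * zext f (k - p i)"
    "zext (R f) k = of_real (sqrt (\<gamma> k / \<gamma> (k - p j))) * zext f (k - p j)"
    "zext (S' f) k = (if 0 \<le> fst k \<and> 0 \<le> snd k
      then of_real (sqrt (\<gamma> (k + p i) / \<gamma> k)) * zext f (k + p i) else 0)"
    "zext (R' f) k = (if 0 \<le> fst k \<and> 0 \<le> snd k
      then of_real (sqrt (\<gamma> (k + p j) / \<gamma> k)) * zext f (k + p j) else 0)" for f k
    using S R by blast+
  have C: "cinner (commutator (cadj R) S (x j)) (x i)
      = cinner (S (x j)) (R (x i)) - cinner (R' (x j)) (S' (x i))"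
    unfolding commutator_def cadj_eq[OF adj(2)] cinner_diff_left
    using adjoint_pairD[OF adj(1)] adjoint_pairD[OF adjoint_pair_sym[OF adj(2)]] by simp
  have A: "((\<lambda>u. of_real (\<gamma> (u + p i + p j)) * (Z u j * cnj (Z u i)))
      has_sum cinner (S (x j)) (R (x i))) UNIV"
  proof -
    have "((\<lambda>u. zext (S (x j)) (u + (p i + p j)) * cnj (zext (R (x i)) (u + (p i + p j))))
        has_sum cinner (S (x j)) (R (x i))) UNIV"
      using has_sum_zext by (subst has_sum_reindex_bij_betw[OF bij_translate])
    moreover have "zext (S (x j)) (u + (p i + p j)) * cnj (zext (R (x i)) (u + (p i + p j)))
        = of_real (\<gamma> (u + p i + p j)) * (Z u j * cnj (Z u i))" for u
    proof -
      have "u + (p i + p j) - p i = u + p j" "u + (p i + p j) - p j = u + p i"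
        by (simp_all add: algebra_simps)
      then have "zext (S (x j)) (u + (p i + p j)) = of_real (sqrt (\<gamma> (u + p i + p j))) * Z u j"
        "zext (R (x i)) (u + (p i + p j)) = of_real (sqrt (\<gamma> (u + p i + p j))) * Z u i"
        unfolding zext by (simp_all add: Z_def normalized_def real_sqrt_divide add.assoc)
      moreover have "complex_of_real (sqrt (\<gamma> (u + p i + p j))) * of_real (sqrt (\<gamma> (u + p i + p j)))
          = of_real (\<gamma> (u + p i + p j))"
        using pos[of "u + p i + p j"] by (simp flip: of_real_mult)
      ultimately show ?thesis by (simp add: algebra_simps)
    qed
    ultimately show ?thesis by simp
  qed
  have B: "((\<lambda>u. of_real (if 0 \<le> fst u \<and> 0 \<le> snd u then \<gamma> (u + p i) * \<gamma> (u + p j) / \<gamma> u else 0)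
      * (Z u j * cnj (Z u i))) has_sum cinner (R' (x j)) (S' (x i))) UNIV"
  proof (rule has_sum_cong[THEN iffD1, OF _ has_sum_zext])
    fix u :: "int \<times> int"
    have Z: "zext (x l) (u + p l) = of_real (sqrt (\<gamma> (u + p l))) * Z u l" for l
      using pos[of "u + p l"] by (simp add: Z_def normalized_def)
    have w: "sqrt (\<gamma> (u + p l) / \<gamma> u) * sqrt (\<gamma> (u + p l)) = \<gamma> (u + p l) / sqrt (\<gamma> u)" for l
      using pos[of "u + p l"] by (simp add: real_sqrt_divide)
    have "complex_of_real (sqrt (\<gamma> (u + p l) / \<gamma> u)) * zext (x l) (u + p l)
        = of_real (\<gamma> (u + p l) / sqrt (\<gamma> u)) * Z u l" for l
      unfolding Z w[symmetric] by simp
    moreover have "(\<gamma> (u + p j) / sqrt (\<gamma> u)) * (\<gamma> (u + p i) / sqrt (\<gamma> u))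
        = \<gamma> (u + p i) * \<gamma> (u + p j) / \<gamma> u"
      using pos[of u] by (simp add: mult.commute)
    then have "complex_of_real (\<gamma> (u + p j) / sqrt (\<gamma> u)) * of_real (\<gamma> (u + p i) / sqrt (\<gamma> u))
        = of_real (\<gamma> (u + p i) * \<gamma> (u + p j) / \<gamma> u)"
      by (simp only: of_real_mult[symmetric])
    then have "complex_of_real (\<gamma> (u + p j) / sqrt (\<gamma> u)) * a * (of_real (\<gamma> (u + p i) / sqrt (\<gamma> u)) * b)
        = of_real (\<gamma> (u + p i) * \<gamma> (u + p j) / \<gamma> u) * (a * b)" for a b
      by (metis mult.assoc mult.left_commute)
    ultimately show "zext (R' (x j)) u * cnj (zext (S' (x i)) u)
        = of_real (if 0 \<le> fst u \<and> 0 \<le> snd u then \<gamma> (u + p i) * \<gamma> (u + p j) / \<gamma> u else 0)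
          * (Z u j * cnj (Z u i))"
      unfolding zext by (simp del: of_real_divide of_real_mult)
  qed
  show ?thesis
    using has_sum_add[OF A has_sum_uminusI[OF B]]
    unfolding add_uminus_conv_diff C of_real_diff left_diff_distrib Z_def .
qed

section \<open>The commutator form as a sum of real quadratic forms\<close>

lemma has_sum_sum:
  fixes f :: "'i \<Rightarrow> 'a \<Rightarrow> 'b :: {comm_monoid_add, topological_comm_monoid_add}"
  assumes "\<And>i. i \<in> I \<Longrightarrow> (f i has_sum s i) A"
  shows "((\<lambda>x. \<Sum>i\<in>I. f i x) has_sum (\<Sum>i\<in>I. s i)) A"
  using assms by (induction I rule: infinite_finite_induct) (auto intro: has_sum_add has_sum_0)

lemma deficit_eq:
  "deficit \<gamma> p n u z = (\<Sum>i<n. \<Sum>j<n. (\<gamma> (u + p i + p j) - (if 0 \<le> fst u \<and> 0 \<le> snd u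
        then \<gamma> (u + p i) * \<gamma> (u + p j) / \<gamma> u else 0)) * (z i * z j))"
proof -
  have "(\<Sum>j<n. \<gamma> (u + p j) * z j)\<^sup>2 / \<gamma> u
      = (\<Sum>i<n. \<Sum>j<n. \<gamma> (u + p i) * \<gamma> (u + p j) / \<gamma> u * (z i * z j))"
    unfolding power2_eq_square sum_product sum_divide_distrib
    by (intro sum.cong refl) simp
  then show ?thesis
    unfolding deficit_def
    by (cases "0 \<le> fst u \<and> 0 \<le> snd u")
      (auto simp: left_diff_distrib sum_subtractf mult.assoc)
qed

text \<open>For a real symmetric matrix the mixed terms cancel in pairs, so it suffices to test real
  vectors.\<close>

lemma sum_sesquilinear_symmetric:
  fixes G :: "nat \<Rightarrow> nat \<Rightarrow> real" and Z :: "nat \<Rightarrow> complex"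
  assumes sym: "\<And>i j. G i j = G j i"
  shows "(\<Sum>i<n. \<Sum>j<n. of_real (G i j) * (Z j * cnj (Z i)))
    = of_real ((\<Sum>i<n. \<Sum>j<n. G i j * (Re (Z i) * Re (Z j))) + (\<Sum>i<n. \<Sum>j<n. G i j * (Im (Z i) * Im (Z j))))"
proof (rule complex_eqI)
  have "(\<Sum>i<n. \<Sum>j<n. G i j * (Im (Z j) * Re (Z i))) = (\<Sum>j<n. \<Sum>i<n. G i j * (Im (Z j) * Re (Z i)))"
    by (rule sum.swap)
  also have "\<dots> = (\<Sum>i<n. \<Sum>j<n. G i j * (Re (Z j) * Im (Z i)))"
    by (intro sum.cong refl) (simp add: sym mult.commute)
  finally show "Im (\<Sum>i<n. \<Sum>j<n. of_real (G i j) * (Z j * cnj (Z i)))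
    = Im (of_real ((\<Sum>i<n. \<Sum>j<n. G i j * (Re (Z i) * Re (Z j))) + (\<Sum>i<n. \<Sum>j<n. G i j * (Im (Z i) * Im (Z j)))))"
    by (simp add: sum_subtractf right_diff_distrib)
qed (simp add: sum.distrib distrib_left mult.commute)

lemma has_sum_commutator_form:
  assumes pos: "\<And>k. 0 < \<gamma> k"
    and S: "\<forall>i<length S. \<exists>S'. moment_shift \<gamma> (p i) (S ! i) S'"
  shows "((\<lambda>u. complex_of_real (deficit \<gamma> p (length S) u (\<lambda>j. Re (normalized \<gamma> p x u j))
      + deficit \<gamma> p (length S) u (\<lambda>j. Im (normalized \<gamma> p x u j))))
    has_sum (\<Sum>i<length S. cinner (\<Sum>j<length S. commutator (cadj (S ! j)) (S ! i) (x j)) (x i))) UNIV"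
proof -
  define G where "G u i j = \<gamma> (u + p i + p j) - (if 0 \<le> fst u \<and> 0 \<le> snd u
        then \<gamma> (u + p i) * \<gamma> (u + p j) / \<gamma> u else 0)" for u i j
  have sym: "G u i j = G u j i" for u i j
    by (simp add: G_def add_ac mult.commute)
  have "((\<lambda>u. \<Sum>i<length S. \<Sum>j<length S. of_real (G u i j) * (normalized \<gamma> p x u j * cnj (normalized \<gamma> p x u i)))
    has_sum (\<Sum>i<length S. \<Sum>j<length S. cinner (commutator (cadj (S ! j)) (S ! i) (x j)) (x i))) UNIV"
    unfolding G_def
  proof (intro has_sum_sum)
    fix i j assume "i \<in> {..<length S}" "j \<in> {..<length S}"
    then obtain S' R' where "moment_shift \<gamma> (p i) (S ! i) S'" "moment_shift \<gamma> (p j) (S ! j) R'"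
      using S by blast
    then show "((\<lambda>u. of_real (\<gamma> (u + p i + p j) - (if 0 \<le> fst u \<and> 0 \<le> snd u
        then \<gamma> (u + p i) * \<gamma> (u + p j) / \<gamma> u else 0))
      * (normalized \<gamma> p x u j * cnj (normalized \<gamma> p x u i)))
      has_sum cinner (commutator (cadj (S ! j)) (S ! i) (x j)) (x i)) UNIV"
      by (rule has_sum_commutator_entry[OF pos])
  qed
  then show ?thesis
    unfolding sum_sesquilinear_symmetric[of "G _", OF sym] cinner_sum_left
    unfolding deficit_eq G_def .
qed

text \<open>Indices \<open>u\<close> outside the quadrant contribute too, since
  \<open>u + p j\<close> may lie inside. Coordinates outside the quadrant are zero, which restricts
  the \<open>z\<close> to be tested.\<close>

lemma hyponormal_tupleI:
  assumes pos: "\<And>k. 0 < \<gamma> k"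
    and S: "\<forall>i<length S. \<exists>S'. moment_shift \<gamma> (p i) (S ! i) S'"
    and nonneg: "\<And>u z. (\<And>j. j < length S \<Longrightarrow> z j \<noteq> 0 \<Longrightarrow> 0 \<le> fst (u + p j) \<and> 0 \<le> snd (u + p j)) \<Longrightarrow>
      0 \<le> deficit \<gamma> p (length S) u z"
  shows "hyponormal_tuple S"
  unfolding hyponormal_tuple_def
proof (intro conjI ballI allI)
  fix T assume "T \<in> set S"
  then show "bounded_clinear T"
    using S unfolding in_set_conv_nth moment_shift_def by blast
next
  fix x :: "nat \<Rightarrow> (nat \<times> nat) ell2"
  let ?s = "\<Sum>i<length S. cinner (\<Sum>j<length S. commutator (cadj (S ! j)) (S ! i) (x j)) (x i)"
  have "0 \<le> deficit \<gamma> p (length S) u (\<lambda>j. Re (normalized \<gamma> p x u j))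
      + deficit \<gamma> p (length S) u (\<lambda>j. Im (normalized \<gamma> p x u j))" for u
    by (intro add_nonneg_nonneg nonneg) (auto simp: normalized_def zext_def split: if_splits)
  moreover note hs = has_sum_commutator_form[OF pos S, of x]
  ultimately have "0 \<le> Re ?s"
    by (intro has_sum_nonneg[OF has_sum_Re[OF hs]]) simp_all
  moreover have "Im ?s = 0"
    using has_sum_unique[OF has_sum_Im[OF hs]] by simp
  ultimately show "?s \<in> \<real>\<^sub>\<ge>\<^sub>0"
    by (simp add: complex_nonneg_Reals_iff)
qed

lemma hyponormal_tupleD:
  assumes pos: "\<And>k. 0 < \<gamma> k"
    and S: "\<forall>i<length S. \<exists>S'. moment_shift \<gamma> (p i) (S ! i) S'"
    and p: "\<And>i. i < length S \<Longrightarrow> 0 \<le> fst (p i) \<and> 0 \<le> snd (p i)"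
    and hyp: "hyponormal_tuple S"
  shows "0 \<le> deficit \<gamma> p (length S) 0 z"
proof -
  \<comment> \<open>Test vectors supported at the exponents \<open>p j\<close> leave only the
    summand \<open>u = 0\<close>; the root cancels the one in \<open>normalized\<close>.\<close>
  define x where "x j = of_real (sqrt (\<gamma> (p j)) * z j) *\<^sub>C ket (nat (fst (p j)), nat (snd (p j)))" for j
  let ?s = "\<Sum>i<length S. cinner (\<Sum>j<length S. commutator (cadj (S ! j)) (S ! i) (x j)) (x i)"
  let ?q = "\<lambda>u. deficit \<gamma> p (length S) u (\<lambda>j. Re (normalized \<gamma> p x u j))
      + deficit \<gamma> p (length S) u (\<lambda>j. Im (normalized \<gamma> p x u j))"
  have norm: "normalized \<gamma> p x u j = (if u = 0 then of_real (z j) else 0)" if "j < length S" for u j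
  proof -
    have "zext (ket (nat (fst (p j)), nat (snd (p j)))) (u + p j) = (if u = 0 then 1 else 0)"
      using p[OF that] by (cases u; cases "p j") (auto simp: zext_def ket.rep_eq zero_prod_def)
    moreover have "zext (c *\<^sub>C f) k = c * zext f k" for c f k
      by (simp add: zext_def scaleC.rep_eq)
    ultimately show ?thesis
      using pos[of "p j"] by (simp add: normalized_def x_def)
  qed
  have q: "?q u = (if u = 0 then deficit \<gamma> p (length S) 0 z else 0)" for u
    unfolding deficit_def by (auto simp: norm)
  have "((\<lambda>u :: int \<times> int. complex_of_real (if u = 0 then deficit \<gamma> p (length S) 0 z else 0)) has_sum ?s) UNIV"
    using has_sum_commutator_form[OF pos S, of x] unfolding q .
  moreover have "((\<lambda>u :: int \<times> int. complex_of_real (if u = 0 then deficit \<gamma> p (length S) 0 z else 0))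
      has_sum of_real (deficit \<gamma> p (length S) 0 z)) UNIV"
    by (rule has_sum_cong_neutral[THEN iffD1, OF _ _ _ has_sum_finite[of "{0}"], THEN back_subst[of "\<lambda>s. (_ has_sum s) _"]]) auto
  ultimately have "?s = of_real (deficit \<gamma> p (length S) 0 z)"
    by (rule has_sum_unique)
  moreover have "?s \<in> \<real>\<^sub>\<ge>\<^sub>0" using hyp unfolding hyponormal_tuple_def by blast
  ultimately show ?thesis by simp
qed

section \<open>The moments of the shift\<close>

text \<open>An algebraic form of the positivity of the integral of (sum of z_i s^(x_i - 1/2))^2 over
  [0,1]. The induction works because a Schur complement of a Cauchy matrix is again a Cauchy matrix,
  up to a diagonal congruence.\<close>

lemma cauchy_matrix_nonneg:
  fixes x z :: "'a \<Rightarrow> real"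
  assumes "finite I" "\<And>i. i \<in> I \<Longrightarrow> 0 < x i"
  shows "0 \<le> (\<Sum>i\<in>I. \<Sum>j\<in>I. z i * z j / (x i + x j))"
  using assms
proof (induction I arbitrary: z rule: finite_induct)
  case (insert k I)
  define s where "s = (\<Sum>i\<in>I. z i / (x i + x k))"
  define z' where "z' i = z i * (x i - x k) / (x i + x k)" for i
  have pos: "0 < x i" if "i \<in> I" for i
    using insert.prems that by auto
  have k: "0 < x k" using insert.prems by auto
  text \<open>Schur complement with respect to the index \<open>k\<close>.\<close>
  have schur: "z i * z j / (x i + x j) = z' i * z' j / (x i + x j)
      + 2 * x k * ((z i / (x i + x k)) * (z j / (x j + x k)))" if "i \<in> I" "j \<in> I" for i j
  proof -
    have comb: "a / q * (b / r) / p + 2 * t * (c / q * (d / r)) = (a * b + 2 * t * p * (c * d)) / (p * q * r)"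
      if "p \<noteq> 0" "q \<noteq> 0" "r \<noteq> 0" for a b c d p q r t :: real
      using that by (simp add: field_simps)
    have nz: "x i + x j \<noteq> 0" "x i + x k \<noteq> 0" "x j + x k \<noteq> 0"
      using pos[OF that(1)] pos[OF that(2)] k by linarith+
    have "z i * (x i - x k) * (z j * (x j - x k)) + 2 * x k * (x i + x j) * (z i * z j)
        = (z i * z j) * ((x i + x k) * (x j + x k))"
      by algebra
    then show ?thesis
      unfolding z'_def comb[OF nz] using nz by simp
  qed
  have "(\<Sum>i\<in>insert k I. \<Sum>j\<in>insert k I. z i * z j / (x i + x j))
      = z k * z k / (2 * x k) + 2 * z k * s + (\<Sum>i\<in>I. \<Sum>j\<in>I. z i * z j / (x i + x j))"
  proof -
    have "(\<Sum>j\<in>I. z k * z j / (x k + x j)) = z k * s" "(\<Sum>i\<in>I. z i * z k / (x i + x k)) = z k * s"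
      unfolding s_def sum_distrib_left by (intro sum.cong refl; simp add: add.commute mult.commute)+
    then show ?thesis
      using insert.hyps by (simp add: sum.distrib)
  qed
  also have "(\<Sum>i\<in>I. \<Sum>j\<in>I. z i * z j / (x i + x j))
      = (\<Sum>i\<in>I. \<Sum>j\<in>I. z' i * z' j / (x i + x j)) + 2 * x k * (s * s)"
  proof -
    have ss: "s * s = (\<Sum>i\<in>I. \<Sum>j\<in>I. (z i / (x i + x k)) * (z j / (x j + x k)))"
      unfolding s_def by (rule sum_product)
    show ?thesis
      unfolding ss sum_distrib_left sum.distrib[symmetric] by (intro sum.cong refl schur)
  qed
  also have "z k * z k / (2 * x k) + 2 * z k * s +
      ((\<Sum>i\<in>I. \<Sum>j\<in>I. z' i * z' j / (x i + x j)) + 2 * x k * (s * s))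
      = 2 * x k * (z k / (2 * x k) + s)\<^sup>2 + (\<Sum>i\<in>I. \<Sum>j\<in>I. z' i * z' j / (x i + x j))"
    using k by (simp add: power2_eq_square distrib_left distrib_right add_divide_distrib)
  finally show ?case
    using insert.IH[of z'] pos k by simp
qed simp

text \<open>At \<open>(i, j)\<close> in the quadrant this is the squared norm of T1^i T2^j e_0. The
  tests \<open>\<le> 0\<close> clamp negative coordinates to 0, which keeps all quotients of moments
  positive.\<close>

definition mom :: "real \<Rightarrow> real \<Rightarrow> int \<times> int \<Rightarrow> real"
  where "mom \<kappa> a k =
    (if snd k \<le> 0
     then if fst k \<le> 0 then 1 else \<kappa>\<^sup>2 * (real_of_int (fst k) + 2) / (2 * (real_of_int (fst k) + 1))
     else if fst k \<le> 0 then \<kappa>\<^sup>2 else \<kappa>\<^sup>2 * a\<^sup>2)"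

lemma mom_pos: "\<kappa> \<noteq> 0 \<Longrightarrow> a \<noteq> 0 \<Longrightarrow> 0 < mom \<kappa> a k"
  by (auto simp: mom_def)

text \<open>The moments are those of \<open>\<kappa>\<^sup>2\<close> times the positive measure
  \<open>a\<^sup>2 \<delta>(1,1) + (1 - a\<^sup>2) \<delta>(0,1) + (1/2 - a\<^sup>2) \<delta>(1,0) + ds/2\<close> (the last on \<open>[0,1] \<times> {0}\<close>)
  plus a possibly negative mass at the origin.\<close>

lemma mom_decomposition:
  assumes "0 \<le> fst k" "0 \<le> snd k"
  shows "mom \<kappa> a k = (if k = 0 then 1 - \<kappa>\<^sup>2 * (2 - a\<^sup>2) else 0)
    + \<kappa>\<^sup>2 * (a\<^sup>2 + (if fst k = 0 then 1 - a\<^sup>2 else 0)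
      + (if snd k = 0 then 1/2 - a\<^sup>2 + 1 / (2 * (real_of_int (fst k) + 1)) else 0))"
proof (cases "fst k = 0 \<or> snd k \<noteq> 0")
  case True
  then show ?thesis using assms by (cases k) (auto simp: mom_def zero_prod_def algebra_simps)
next
  case False
  then have "real_of_int (fst k) + 1 > 0" using assms by linarith
  then show ?thesis using assms False
    by (cases k) (auto simp: mom_def zero_prod_def field_simps)
qed

section \<open>Positivity of the moment matrices\<close>

definition moment_form ::
    "(int \<times> int \<Rightarrow> real) \<Rightarrow> (nat \<Rightarrow> int \<times> int) \<Rightarrow> nat \<Rightarrow> int \<times> int \<Rightarrow> (nat \<Rightarrow> real) \<Rightarrow> real"
  where "moment_form \<gamma> p n u z = (\<Sum>i<n. \<Sum>j<n. \<gamma> (u + p i + p j) * z i * z j)"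

text \<open>The form integrates the monomial with exponent \<open>u\<close> times the square of the
  polynomial with coefficients \<open>z\<close>. Each point mass gives a squared value, and Lebesgue
  measure on the edge gives a Cauchy form.\<close>

lemma moment_form_mom:
  assumes p: "\<And>j. 0 \<le> fst (p j) \<and> 0 \<le> snd (p j)"
    and z: "\<forall>j<n. z j \<noteq> 0 \<longrightarrow> 0 \<le> fst (u + p j) \<and> 0 \<le> snd (u + p j)"
  shows "moment_form (mom \<kappa> a) p n u z =
    (if u = 0 then (1 - \<kappa>\<^sup>2 * (2 - a\<^sup>2)) * (\<Sum>j<n. if p j = 0 then z j else 0)\<^sup>2 else 0)
    + \<kappa>\<^sup>2 * (a\<^sup>2 * (\<Sum>j<n. z j)\<^sup>2
      + (if fst u = 0 then (1 - a\<^sup>2) * (\<Sum>j<n. if fst (p j) = 0 then z j else 0)\<^sup>2 else 0)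
      + (if snd u = 0 then (1/2 - a\<^sup>2) * (\<Sum>j<n. if snd (p j) = 0 then z j else 0)\<^sup>2
        + (\<Sum>i<n. \<Sum>j<n. if snd (p i) = 0 \<and> snd (p j) = 0
            then z i * z j / (real_of_int (fst u) + fst (p i) + fst (p j) + 1) else 0) / 2 else 0))"
proof -
  have entry: "mom \<kappa> a (u + p i + p j) * z i * z j =
    (if u = 0 then 1 - \<kappa>\<^sup>2 * (2 - a\<^sup>2) else 0) * ((if p i = 0 then z i else 0) * (if p j = 0 then z j else 0))
    + \<kappa>\<^sup>2 * (a\<^sup>2 * (z i * z j)
      + (if fst u = 0 then 1 - a\<^sup>2 else 0) * ((if fst (p i) = 0 then z i else 0) * (if fst (p j) = 0 then z j else 0))
      + (if snd u = 0 then 1/2 - a\<^sup>2 else 0) * ((if snd (p i) = 0 then z i else 0) * (if snd (p j) = 0 then z j else 0))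
      + (if snd u = 0 then 1/2 else 0) * (if snd (p i) = 0 \<and> snd (p j) = 0
            then z i * z j / (real_of_int (fst u) + fst (p i) + fst (p j) + 1) else 0))"
    if ij: "i < n" "j < n" for i j
  proof (cases "z i = 0 \<or> z j = 0")
    case False
    have nonneg: "0 \<le> fst (u + p i)" "0 \<le> snd (u + p i)" "0 \<le> fst (u + p j)" "0 \<le> snd (u + p j)"
      "0 \<le> fst (p i)" "0 \<le> snd (p i)" "0 \<le> fst (p j)" "0 \<le> snd (p j)"
      using z ij False p by auto
    then have "0 \<le> fst (u + p i + p j)" "0 \<le> snd (u + p i + p j)"
      by simp_all
    note d = mom_decomposition[OF this, of \<kappa> a]
    \<comment> \<open>\<open>u\<close> may have negative coordinates, so the exponent is grouped
      both as \<open>(u + p i) + p j\<close> and as \<open>(u + p j) + p i\<close>, each with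
      nonnegative summands.\<close>
    have eq0: "fst (u + p i + p j) = 0 \<longleftrightarrow> fst u = 0 \<and> fst (p i) = 0 \<and> fst (p j) = 0"
      "snd (u + p i + p j) = 0 \<longleftrightarrow> snd u = 0 \<and> snd (p i) = 0 \<and> snd (p j) = 0"
      "u + p i + p j = 0 \<longleftrightarrow> u = 0 \<and> p i = 0 \<and> p j = 0"
      using nonneg unfolding prod_eq_iff fst_zero snd_zero by auto
    show ?thesis
      unfolding d eq0
      by (cases "u = 0 \<and> p i = 0 \<and> p j = 0"; cases "fst u = 0 \<and> fst (p i) = 0 \<and> fst (p j) = 0";
          cases "snd u = 0 \<and> snd (p i) = 0 \<and> snd (p j) = 0")
        (auto simp: algebra_simps)
  qed auto
  have sq: "(\<Sum>j<n. f j)\<^sup>2 = (\<Sum>i<n. \<Sum>j<n. f i * f j)" for f :: "nat \<Rightarrow> real"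
    by (simp add: power2_eq_square sum_product)
  have "moment_form (mom \<kappa> a) p n u z =
    (if u = 0 then 1 - \<kappa>\<^sup>2 * (2 - a\<^sup>2) else 0) * (\<Sum>j<n. if p j = 0 then z j else 0)\<^sup>2
    + \<kappa>\<^sup>2 * (a\<^sup>2 * (\<Sum>j<n. z j)\<^sup>2
      + (if fst u = 0 then 1 - a\<^sup>2 else 0) * (\<Sum>j<n. if fst (p j) = 0 then z j else 0)\<^sup>2
      + (if snd u = 0 then 1/2 - a\<^sup>2 else 0) * (\<Sum>j<n. if snd (p j) = 0 then z j else 0)\<^sup>2
      + (if snd u = 0 then 1/2 else 0) * (\<Sum>i<n. \<Sum>j<n. if snd (p i) = 0 \<and> snd (p j) = 0
            then z i * z j / (real_of_int (fst u) + fst (p i) + fst (p j) + 1) else 0))"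
    unfolding moment_form_def sq sum_distrib_left sum.distrib[symmetric]
    by (intro sum.cong refl) (use entry in simp)
  then show ?thesis by (auto simp: algebra_simps)
qed

text \<open>For \<open>u \<noteq> 0\<close> the mass at the origin, the only one of uncertain sign,
  drops out.\<close>

lemma moment_form_nonneg:
  assumes p: "\<And>j. 0 \<le> fst (p j) \<and> 0 \<le> snd (p j)"
    and z: "\<And>j. j < n \<Longrightarrow> z j \<noteq> 0 \<Longrightarrow> 0 \<le> fst (u + p j) \<and> 0 \<le> snd (u + p j)"
    and a: "a\<^sup>2 \<le> 1/2" and u: "u \<noteq> 0"
  shows "0 \<le> moment_form (mom \<kappa> a) p n u z"
proof -
  \<comment> \<open>Indices with \<open>z j = 0\<close> are discarded because their nodes
    \<open>x j\<close> might not be positive. Dividing \<open>fst u + 1\<close> equally between the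
    two nodes puts the edge term into Cauchy form.\<close>
  define I where "I = {j. j < n \<and> snd (p j) = 0 \<and> z j \<noteq> 0}"
  define x where "x j = (real_of_int (fst u) + 1) / 2 + fst (p j)" for j
  have I: "finite I" by (simp add: I_def)
  have "0 < x j" if "j \<in> I" for j
  proof -
    have "0 \<le> fst u + fst (p j)" "0 \<le> fst (p j)"
      using z[of j] p[of j] that by (auto simp: I_def)
    then have "0 < real_of_int (fst u + 1 + 2 * fst (p j))" by linarith
    then show ?thesis by (simp add: x_def field_simps)
  qed
  then have "0 \<le> (\<Sum>i\<in>I. \<Sum>j\<in>I. z i * z j / (x i + x j))"
    by (rule cauchy_matrix_nonneg[OF I])
  also have "\<dots> = (\<Sum>(i, j)\<in>I \<times> I. z i * z j / (x i + x j))"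
    by (rule sum.cartesian_product)
  also have "\<dots> = (\<Sum>(i, j)\<in>{..<n} \<times> {..<n}. if snd (p i) = 0 \<and> snd (p j) = 0
            then z i * z j / (real_of_int (fst u) + fst (p i) + fst (p j) + 1) else 0)"
    by (rule sum.mono_neutral_cong_left)
      (auto simp: I_def x_def add_divide_distrib add_ac split: if_splits)
  also have "\<dots> = (\<Sum>i<n. \<Sum>j<n. if snd (p i) = 0 \<and> snd (p j) = 0
            then z i * z j / (real_of_int (fst u) + fst (p i) + fst (p j) + 1) else 0)"
    by (rule sum.cartesian_product[symmetric])
  finally have "0 \<le> \<dots>" .
  moreover have "\<forall>j<n. z j \<noteq> 0 \<longrightarrow> 0 \<le> fst (u + p j) \<and> 0 \<le> snd (u + p j)"
    using z by blast
  note eq = moment_form_mom[OF p this]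
  ultimately show ?thesis
    using a u unfolding eq
    by (auto intro!: mult_nonneg_nonneg add_nonneg_nonneg)
qed

text \<open>Completing the square in the coefficient \<open>t\<close> of the exponent 0:
  \<open>deficit\<close> is the minimum of the enlarged moment form over \<open>t\<close>.\<close>

lemma moment_form_Suc:
  assumes pos: "0 < \<gamma> u" and u: "0 \<le> fst u" "0 \<le> snd u"
  shows "moment_form \<gamma> (case_nat 0 p) (Suc n) u (case_nat t z)
    = deficit \<gamma> p n u z + (\<gamma> u * t + (\<Sum>j<n. \<gamma> (u + p j) * z j))\<^sup>2 / \<gamma> u"
proof -
  define s where "s = (\<Sum>j<n. \<gamma> (u + p j) * z j)"
  have "moment_form \<gamma> (case_nat 0 p) (Suc n) u (case_nat t z)
    = \<gamma> u * t * t + 2 * t * s + moment_form \<gamma> p n u z"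
    unfolding moment_form_def sum.lessThan_Suc_shift s_def
    by (simp add: sum.distrib sum_distrib_left mult_ac)
  then show ?thesis
    using pos u unfolding deficit_def s_def[symmetric] moment_form_def
    by (simp add: power2_eq_square field_simps)
qed

lemma deficit_nonneg:
  assumes p: "\<And>j. 0 \<le> fst (p j) \<and> 0 \<le> snd (p j)"
    and z: "\<And>j. j < n \<Longrightarrow> z j \<noteq> 0 \<Longrightarrow> 0 \<le> fst (u + p j) \<and> 0 \<le> snd (u + p j)"
    and a: "a \<noteq> 0" "a\<^sup>2 \<le> 1/2" and \<kappa>: "\<kappa> \<noteq> 0"
    and zero: "\<And>t. u = 0 \<Longrightarrow> 0 \<le> moment_form (mom \<kappa> a) (case_nat 0 p) (Suc n) 0 (case_nat t z)"
  shows "0 \<le> deficit (mom \<kappa> a) p n u z"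
proof (cases "0 \<le> fst u \<and> 0 \<le> snd u")
  case True
  define t where "t = - (\<Sum>j<n. mom \<kappa> a (u + p j) * z j) / mom \<kappa> a u"
  have pos: "0 < mom \<kappa> a u" using a \<kappa> by (intro mom_pos) auto
  have "deficit (mom \<kappa> a) p n u z = moment_form (mom \<kappa> a) (case_nat 0 p) (Suc n) u (case_nat t z)"
    using moment_form_Suc[of "mom \<kappa> a" u p n t z] pos True by (simp add: t_def)
  also have "0 \<le> \<dots>"
  proof (cases "u = 0")
    case False
    show ?thesis
      by (rule moment_form_nonneg) (use p True a False in \<open>auto split: nat.split\<close>)
  qed (use zero in simp)
  finally show ?thesis .
next
  case False
  then have "deficit (mom \<kappa> a) p n u z = moment_form (mom \<kappa> a) p n u z"
    by (auto simp: deficit_def moment_form_def)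
  also have "0 \<le> \<dots>"
    by (rule moment_form_nonneg[OF p z a(2)]) (use False in auto)
  finally show ?thesis .
qed

text \<open>The exponents follow the order of the tuple in \<open>two_hyponormal\<close>, with T1
  replaced by its \<open>h\<close>-th power.\<close>

definition deg2 :: "nat \<Rightarrow> nat \<Rightarrow> int \<times> int"
  where "deg2 h j = (if j = 0 then (int h, 0) else if j = 1 then (0, 1) else if j = 2 then (2 * int h, 0)
    else if j = 3 then (int h, 1) else (0, 2))"

text \<open>\<open>(1/2 - A) f(1)\<^sup>2 + \<integral>f\<^sup>2 / 2\<close> on \<open>[0,1]\<close> for \<open>f(s) = x + y s\<^sup>h + w s\<^sup>2\<^sup>h\<close>.\<close>

definition edge_form :: "nat \<Rightarrow> real \<Rightarrow> real \<Rightarrow> real \<Rightarrow> real \<Rightarrow> real"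
  where "edge_form h A x y w = (1/2 - A) * (x + y + w)\<^sup>2
    + (x\<^sup>2 + 2 * x * y / (h + 1) + (y\<^sup>2 + 2 * x * w) / (2 * h + 1) + 2 * y * w / (3 * h + 1)
      + w\<^sup>2 / (4 * h + 1)) / 2"

lemma moment_form_origin:
  assumes h: "h \<noteq> 0"
  shows "moment_form (mom \<kappa> a) (case_nat 0 (deg2 h)) 6 0 (case_nat t z)
    = (1 - \<kappa>\<^sup>2 * (2 - a\<^sup>2)) * t\<^sup>2 + \<kappa>\<^sup>2 * (a\<^sup>2 * (t + z 0 + z 1 + z 2 + z 3 + z 4)\<^sup>2
      + (1 - a\<^sup>2) * (t + z 1 + z 4)\<^sup>2 + edge_form h (a\<^sup>2) t (z 0) (z 2))"
proof -
  have nums: "{..<6 :: nat} = {0, 1, 2, 3, 4, 5}" by auto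
  have "(\<Sum>j<6. f j) = f 0 + f (Suc 0) + f (Suc 1) + f (Suc 2) + f (Suc 3) + f (Suc 4)" for f :: "nat \<Rightarrow> real"
    unfolding nums by (simp add: numeral_eq_Suc)
  note expand = this
  have p: "0 \<le> fst (case_nat 0 (deg2 h) j) \<and> 0 \<le> snd (case_nat 0 (deg2 h) j)" for j
    by (auto simp: deg2_def split: nat.split)
  show ?thesis
    using h
    by (subst moment_form_mom[OF p])
      (use p in \<open>simp_all add: expand deg2_def zero_prod_def edge_form_def power2_eq_square add_ac
        add_divide_distrib distrib_left mult_ac del: mult_Suc\<close>)
qed

text \<open>Terms containing the second variable can cancel the values at (1,1) and (0,1) without
  changing the polynomial on the edge. What remains is the mass at the origin plus
  \<open>\<kappa>\<^sup>2\<close> times the minimum \<open>m\<close> of the edge form.\<close>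

lemma hyponormal_iff:
  assumes a: "a \<noteq> 0" "a\<^sup>2 \<le> 1/2" and \<kappa>: "\<kappa> \<noteq> 0" and h: "h \<noteq> 0"
    and len: "length S = 5"
    and S: "\<forall>i<length S. \<exists>S'. moment_shift (mom \<kappa> a) (deg2 h i) (S ! i) S'"
    and min: "\<And>x y w. m * x\<^sup>2 \<le> edge_form h (a\<^sup>2) x y w" and attained: "edge_form h (a\<^sup>2) 1 b c = m"
  shows "hyponormal_tuple S \<longleftrightarrow> 0 \<le> 1 - \<kappa>\<^sup>2 * (2 - a\<^sup>2 - m)"
proof
  have p: "0 \<le> fst (deg2 h j) \<and> 0 \<le> snd (deg2 h j)" for j
    by (simp add: deg2_def)
  have pos: "0 < mom \<kappa> a k" for k using a \<kappa> by (intro mom_pos)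
  have six: "Suc 5 = 6" by simp
  {
    assume hyp: "hyponormal_tuple S"
    text \<open>The minimising polynomial, completed by terms in \<open>t\<close> so that it vanishes at \<open>(1,1)\<close> and \<open>(0,1)\<close>.\<close>
    define z :: "nat \<Rightarrow> real" where "z = (\<lambda>_. 0)(0 := b, 1 := - 1, 2 := c, 3 := - (b + c))"
    have "0 \<le> deficit (mom \<kappa> a) (deg2 h) 5 0 z"
      using hyponormal_tupleD[OF pos S p hyp] unfolding len .
    also have "\<dots> \<le> moment_form (mom \<kappa> a) (case_nat 0 (deg2 h)) (Suc 5) 0 (case_nat 1 z)"
      using pos[of 0] by (subst moment_form_Suc) simp_all
    also have "\<dots> = 1 - \<kappa>\<^sup>2 * (2 - a\<^sup>2 - m)"
      unfolding six moment_form_origin[OF h] using attained by (simp add: z_def algebra_simps)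
    finally show "0 \<le> 1 - \<kappa>\<^sup>2 * (2 - a\<^sup>2 - m)" .
  }
  {
    assume c: "0 \<le> 1 - \<kappa>\<^sup>2 * (2 - a\<^sup>2 - m)"
    show "hyponormal_tuple S"
    proof (rule hyponormal_tupleI[OF pos S])
      fix u and z :: "nat \<Rightarrow> real"
      assume z: "\<And>j. j < length S \<Longrightarrow> z j \<noteq> 0 \<Longrightarrow> 0 \<le> fst (u + deg2 h j) \<and> 0 \<le> snd (u + deg2 h j)"
      show "0 \<le> deficit (mom \<kappa> a) (deg2 h) (length S) u z"
      proof (rule deficit_nonneg[OF p z a \<kappa>])
        fix t
        have "0 \<le> (1 - \<kappa>\<^sup>2 * (2 - a\<^sup>2 - m)) * t\<^sup>2" using c by simp
        also have "\<dots> = (1 - \<kappa>\<^sup>2 * (2 - a\<^sup>2)) * t\<^sup>2 + \<kappa>\<^sup>2 * (0 + 0 + m * t\<^sup>2)"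
          by (simp add: algebra_simps)
        also have "\<dots> \<le> moment_form (mom \<kappa> a) (case_nat 0 (deg2 h)) 6 0 (case_nat t z)"
          unfolding moment_form_origin[OF h]
          using a by (intro add_mono mult_left_mono min order_refl mult_nonneg_nonneg) auto
        finally show "0 \<le> moment_form (mom \<kappa> a) (case_nat 0 (deg2 h)) (Suc (length S)) 0 (case_nat t z)"
          unfolding len six .
      qed
    qed
  }
qed

text \<open>\<open>e1\<close> and \<open>e2\<close> say that \<open>(1, b, c)\<close> is stationary under variation of the last two arguments,
  so that \<open>edge_form\<close> splits orthogonally along this vector.\<close>

lemma edge_form_minimum:
  fixes A b c h :: real and k :: nat
  defines "h \<equiv> real k"
  assumes A: "A \<le> 1/2" and k: "k \<noteq> 0"
    and e1: "(1/2 - A) * (1 + b + c) + (1 / (h + 1) + b / (2 * h + 1) + c / (3 * h + 1)) / 2 = 0"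
    and e2: "(1/2 - A) * (1 + b + c) + (1 / (2 * h + 1) + b / (3 * h + 1) + c / (4 * h + 1)) / 2 = 0"
    and m: "m = (1/2 - A) * (1 + b + c) + (1 + b / (h + 1) + c / (2 * h + 1)) / 2"
  shows "m * x\<^sup>2 \<le> edge_form k A x y w" "edge_form k A 1 b c = m"
proof -
  define r1 r2 r3 r4 where r: "r1 = 1 / (h + 1)" "r2 = 1 / (2 * h + 1)" "r3 = 1 / (3 * h + 1)" "r4 = 1 / (4 * h + 1)"
  have E1: "(1/2 - A) * (1 + b + c) + (r1 + b * r2 + c * r3) / 2 = 0"
    and E2: "(1/2 - A) * (1 + b + c) + (r2 + b * r3 + c * r4) / 2 = 0"
    and M: "m = (1/2 - A) * (1 + b + c) + (1 + b * r1 + c * r2) / 2"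
    using e1 e2 m by (simp_all add: r)
  have form: "edge_form k A x y w = (1/2 - A) * (x + y + w)\<^sup>2
      + (x\<^sup>2 + 2 * x * y * r1 + (y\<^sup>2 + 2 * x * w) * r2 + 2 * y * w * r3 + w\<^sup>2 * r4) / 2" for x y w
    by (simp add: edge_form_def r h_def add.commute)
  have split: "edge_form k A x y w = m * x\<^sup>2 + edge_form k A 0 (y - b * x) (w - c * x)" for x y w
  proof -
    have "edge_form k A x y w - (m * x\<^sup>2 + edge_form k A 0 (y - b * x) (w - c * x))
      = (2 * x * y - b * x\<^sup>2) * ((1/2 - A) * (1 + b + c) + (r1 + b * r2 + c * r3) / 2)
        + (2 * x * w - c * x\<^sup>2) * ((1/2 - A) * (1 + b + c) + (r2 + b * r3 + c * r4) / 2)"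
      unfolding form M
      by (simp add: power2_eq_square algebra_simps add_divide_distrib diff_divide_distrib)
    then show ?thesis unfolding E1 E2 by simp
  qed
  have h: "0 < h" using k by (simp add: h_def)
  have "0 \<le> edge_form k A 0 y w" for y w
  proof -
    \<comment> \<open>These nodes have the pairwise sums \<open>2 * h + 1\<close>,
      \<open>3 * h + 1\<close> and \<open>4 * h + 1\<close>, the denominators of the edge integral
      without constant term.\<close>
    define q v where "q i = (if i = 0 then h + 1/2 else 2 * h + 1/2)"
      and "v i = (if i = 0 then y else w)" for i :: nat
    have "0 \<le> (\<Sum>i\<in>{0, 1 :: nat}. \<Sum>j\<in>{0, 1}. v i * v j / (q i + q j))"
      using h by (intro cauchy_matrix_nonneg) (auto simp: q_def)
    also have "\<dots> = y\<^sup>2 * r2 + 2 * y * w * r3 + w\<^sup>2 * r4"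
      by (simp add: q_def v_def r power2_eq_square algebra_simps)
    finally show ?thesis unfolding form using A by simp
  qed
  then show "m * x\<^sup>2 \<le> edge_form k A x y w" unfolding split[of x] by simp
  have "edge_form k A 0 0 0 = 0" unfolding form by simp
  then show "edge_form k A 1 b c = m" using split[of 1 b c] by simp
qed

section \<open>The shift \<open>W\<close>\<close>

text \<open>Line \<open>j\<close> has Berger measure P \<delta>(0) + Q \<delta>(1) + R ds with
  moments \<open>\<gamma> i j\<close>. The shares of the three components in each moment are the
  squares of \<open>p\<close>, \<open>q\<close>, \<open>r\<close> in
  \<open>shift_subnormal\<close>.\<close>

lemma subnormal_of_berger:
  fixes T :: "(nat \<times> nat) operator" and e :: "nat \<times> nat \<Rightarrow> nat \<times> nat" and \<gamma> :: "nat \<Rightarrow> nat \<Rightarrow> real"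
  assumes T: "bounded_clinear T" and e: "\<And>k. e (e k) = k"
    and T0: "\<And>f j. coord (T f) (e (0, j)) = 0"
    and TSuc: "\<And>f i j. coord (T f) (e (Suc i, j))
      = of_real (sqrt (\<gamma> (Suc i) j / \<gamma> i j)) * coord f (e (i, j))"
    and pos: "\<And>i j. 0 < \<gamma> i j" and nonneg: "\<And>j. 0 \<le> P j" "\<And>j. 0 \<le> Q j" "\<And>j. 0 \<le> R j"
    and \<gamma>: "\<And>i j. \<gamma> i j = (if i = 0 then P j else 0) + Q j + R j / (real i + 1)"
  shows "subnormal T" "subnormal (T \<circ> T)"
proof -
  let ?p = "\<lambda>j. sqrt (P j / \<gamma> 0 j)" and ?q = "\<lambda>i j. sqrt (Q j / \<gamma> i j)"
    and ?r = "\<lambda>i j. sqrt (R j / (real i + 1) / \<gamma> i j)"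
  have one: "(if i = 0 then (?p j)\<^sup>2 else 0) + (?q i j)\<^sup>2 + (?r i j)\<^sup>2 = 1" for i j
  proof -
    have "(if i = 0 then (?p j)\<^sup>2 else 0) + (?q i j)\<^sup>2 + (?r i j)\<^sup>2
        = ((if i = 0 then P j else 0) + Q j + R j / (real i + 1)) / \<gamma> i j"
      using nonneg less_imp_le[OF pos] by (simp add: add_divide_distrib)
    then show ?thesis using \<gamma>[of i j] pos[of i j] by simp
  qed
  have q: "?q (Suc i) j * sqrt (\<gamma> (Suc i) j / \<gamma> i j) = ?q i j" for i j
    using pos[of "Suc i" j] by (simp flip: real_sqrt_mult)
  have r: "?r (Suc i) j * sqrt (\<gamma> (Suc i) j / \<gamma> i j) = sqrt ((real i + 1) / (real i + 2)) * ?r i j" for i j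
    unfolding real_sqrt_mult[symmetric]
    using pos[of "Suc i" j] by (simp add: add.commute)
  show "subnormal T" "subnormal (T \<circ> T)"
    by (rule shift_subnormal[OF T e T0 TSuc one q r])+
qed

text \<open>Yields commutativity: both products of two moment shifts have the same total
  exponent.\<close>

lemma moment_shift_unique:
  assumes "moment_shift \<gamma> p S S'" "moment_shift \<gamma> p R R'"
  shows "S = R"
proof
  fix f
  show "S f = R f"
  proof (rule ell2_eqI)
    fix k :: "nat \<times> nat"
    have "zext (S f) (map_prod int int k) = zext (R f) (map_prod int int k)"
      using assms unfolding moment_shift_def by metis
    then show "coord (S f) k = coord (R f) k" by (cases k) (simp add: zext_def)
  qed
qed

text \<open>Moments that do not increase along the translation bound the weights by 1. The
  subtraction in \<open>\<sigma>\<close> truncates only where \<open>w\<close> vanishes.\<close>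

lemma weighted_translation_moment_shift:
  fixes \<gamma> :: "int \<times> int \<Rightarrow> real" and c d :: nat and v :: "nat \<times> nat \<Rightarrow> real"
  defines "T \<equiv> weighted_translation (\<lambda>(i, j). (i + c, j + d)) v"
  assumes pos: "\<And>k. 0 < \<gamma> k"
    and bound: "\<And>i j. \<gamma> (int (i + c), int (j + d)) \<le> \<gamma> (int i, int j)"
    and v: "\<And>i j. v (i, j) = sqrt (\<gamma> (int (i + c), int (j + d)) / \<gamma> (int i, int j))"
  shows "\<exists>T'. moment_shift \<gamma> (int c, int d) T T'"
    and "\<And>f i j. i < c \<or> j < d \<Longrightarrow> coord (T f) (i, j) = 0"
    and "\<And>f i j. coord (T f) (i + c, j + d) = of_real (v (i, j)) * coord f (i, j)"
proof -
  define w where "w = (\<lambda>(i, j). if c \<le> i \<and> d \<le> j then v (i - c, j - d) else 0)"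
  define \<sigma> where "\<sigma> = (\<lambda>(i, j). (i - c, j - d))"
  define \<tau> where "\<tau> = (\<lambda>(i, j). (i + c, j + d))"
  have v1: "\<bar>v (i, j)\<bar> \<le> 1" for i j
    using bound[of i j] pos[of "(int i, int j)"] less_imp_le[OF pos]
    by (simp add: v)
  have tr: "transposed w \<sigma> v \<tau>"
    unfolding transposed_def
  proof (intro conjI allI exI[of _ 1])
    fix k
    show "\<bar>w k\<bar> \<le> 1" by (cases k) (simp add: w_def v1)
    show "w k \<noteq> 0 \<longrightarrow> \<tau> (\<sigma> k) = k \<and> v (\<sigma> k) = w k"
      by (cases k; cases "c \<le> fst k \<and> d \<le> snd k") (simp_all add: w_def \<sigma>_def \<tau>_def)
  qed (simp_all add: w_def \<sigma>_def \<tau>_def split_beta)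
  have T: "T = wcomp w \<sigma>"
    unfolding T_def \<tau>_def[symmetric]
    by (rule weighted_translation_eq_wcomp[OF tr]) (auto simp: w_def \<sigma>_def \<tau>_def split: if_splits)
  have coord_T: "coord (T f) k = of_real (w k) * coord f (\<sigma> k)" for f k
    unfolding T by (rule coord_wcomp[OF tr])
  show "coord (T f) (i, j) = 0" if "i < c \<or> j < d" for f i j
    using that unfolding coord_T by (auto simp: w_def)
  show shift: "coord (T f) (i + c, j + d) = of_real (v (i, j)) * coord f (i, j)" for f i j
    unfolding coord_T by (simp add: w_def \<sigma>_def)
  have fwd: "zext (T f) k = of_real (sqrt (\<gamma> k / \<gamma> (k - (int c, int d)))) * zext f (k - (int c, int d))" for f k
  proof (cases "int c \<le> fst k \<and> int d \<le> snd k")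
    case True
    then have "k = (int (nat (fst k - int c) + c), int (nat (snd k - int d) + d))"
      by (simp add: prod_eq_iff)
    then obtain i j where "k = (int (i + c), int (j + d))" by blast
    then show ?thesis using shift[of f i j] v[of i j] by (simp add: zext_def nat_int_add)
  next
    case False
    then show ?thesis
      unfolding zext_def coord_T by (cases k) (auto simp: w_def)
  qed
  have bwd: "zext (wcomp v \<tau> f) k = (if 0 \<le> fst k \<and> 0 \<le> snd k
      then of_real (sqrt (\<gamma> (k + (int c, int d)) / \<gamma> k)) * zext f (k + (int c, int d)) else 0)" for f k
  proof (cases "0 \<le> fst k \<and> 0 \<le> snd k")
    case True
    then have "k = (int (nat (fst k)), int (nat (snd k)))"
      by (simp add: prod_eq_iff)
    then obtain i j where "k = (int i, int j)" by blast
    moreover have "coord (wcomp v \<tau> f) (i, j) = of_real (v (i, j)) * coord f (\<tau> (i, j))" for i j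
      by (rule coord_wcomp[OF transposed_sym[OF tr]])
    ultimately show ?thesis
      by (simp add: zext_def v \<tau>_def nat_int_add)
  qed (auto simp: zext_def)
  show "\<exists>T'. moment_shift \<gamma> (int c, int d) T T'"
    unfolding moment_shift_def
    using bounded_clinear_wcomp[OF tr] adjoint_pair_wcomp[OF tr] fwd bwd
    by (intro exI[of _ "wcomp v \<tau>"]) (simp add: T[symmetric] del: split_paired_All)
qed

lemma two_hyponormal_iff:
  assumes a: "a \<noteq> 0" "a\<^sup>2 \<le> 1/2" and \<kappa>: "\<kappa> \<noteq> 0" and h: "h \<noteq> 0"
    and A: "moment_shift (mom \<kappa> a) (int h, 0) A A'" and B: "moment_shift (mom \<kappa> a) (0, 1) B B'"
    and min: "\<And>x y w. m * x\<^sup>2 \<le> edge_form h (a\<^sup>2) x y w" and attained: "edge_form h (a\<^sup>2) 1 b c = m"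
  shows "A \<circ> B = B \<circ> A" "two_hyponormal (A, B) \<longleftrightarrow> 0 \<le> 1 - \<kappa>\<^sup>2 * (2 - a\<^sup>2 - m)"
proof -
  have pos: "0 < mom \<kappa> a k" for k using a \<kappa> by (intro mom_pos)
  note comp = moment_shift_comp[of "mom \<kappa> a", OF pos]
  show comm: "A \<circ> B = B \<circ> A"
    using moment_shift_unique[OF comp[OF A B]] comp[OF B A] by (simp add: add.commute)
  let ?S = "[A, B, A \<circ> A, B \<circ> A, B \<circ> B]"
  have "\<exists>S'. moment_shift (mom \<kappa> a) (deg2 h i) (?S ! i) S'" if "i < 5" for i
  proof -
    have "i \<in> {0, 1, 2, 3, 4}" using that by auto
    then show ?thesis
      using A B comp[OF A A] comp[OF B A] comp[OF B B] by (auto simp: deg2_def)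
  qed
  then have "hyponormal_tuple ?S \<longleftrightarrow> 0 \<le> 1 - \<kappa>\<^sup>2 * (2 - a\<^sup>2 - m)"
    by (intro hyponormal_iff[OF a \<kappa> h _ _ min attained]) simp_all
  then show "two_hyponormal (A, B) \<longleftrightarrow> 0 \<le> 1 - \<kappa>\<^sup>2 * (2 - a\<^sup>2 - m)"
    using comm by (simp add: two_hyponormal_def)
qed

section \<open>The weights as quotients of moments\<close>

lemma mom_edge: "mom \<kappa> a (int i, 0) = (if i = 0 then 1 else \<kappa>\<^sup>2 * (real i + 2) / (2 * (real i + 1)))"
  by (simp add: mom_def)

lemma x_wt_eq:
  assumes "0 < \<kappa>"
  shows "x_wt \<kappa> n = sqrt (mom \<kappa> a (int (Suc n), 0) / mom \<kappa> a (int n, 0))"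
proof (cases "n = 0")
  case True
  have "sqrt (\<kappa>\<^sup>2 * (3 / 4)) = \<kappa> * sqrt (3 / 4)"
    using assms by (simp only: real_sqrt_mult real_sqrt_abs)
  then show ?thesis using True unfolding mom_edge x_wt_def by (simp add: mult.commute)
next
  case False
  have "(x_wt \<kappa> n)\<^sup>2 = (real n + 1) * (real n + 3) / (real n + 2)\<^sup>2"
    using False by (simp add: x_wt_def power_divide)
  also have "\<dots> = mom \<kappa> a (int (Suc n), 0) / mom \<kappa> a (int n, 0)"
    using False assms unfolding mom_edge
    by (simp add: power2_eq_square divide_simps) (simp add: algebra_simps)
  finally show ?thesis
    using False by (intro real_sqrt_unique[symmetric]) (simp_all add: x_wt_def)
qed

lemma prod_x_wt:
  assumes "0 < \<kappa>"
  shows "(\<Prod>n<i. x_wt \<kappa> n) = sqrt (mom \<kappa> a (int i, 0))"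
proof (induction i)
  case (Suc i)
  have "0 < mom \<kappa> a (int i, 0)" using assms unfolding mom_edge by simp
  then show ?case
    using Suc x_wt_eq[OF assms, of i a] by (simp add: real_sqrt_divide)
qed (simp add: mom_def)

lemma alpha_wt_eq:
  assumes "0 < \<kappa>" "0 < a"
  shows "alpha_wt \<kappa> a (i, j) = sqrt (mom \<kappa> a (int (i + 1), int (j + 0)) / mom \<kappa> a (int i, int j))"
  using assms x_wt_eq[OF assms(1), of i a] by (auto simp: alpha_wt_def mom_def)

lemma beta_wt_eq:
  assumes "0 < \<kappa>" "0 < a"
  shows "beta_wt \<kappa> a (i, j) = sqrt (mom \<kappa> a (int (i + 0), int (j + 1)) / mom \<kappa> a (int i, int j))"
proof (cases "j = 0 \<and> i \<noteq> 0")
  case True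
  then have "beta_wt \<kappa> a (i, j) = sqrt (\<kappa>\<^sup>2 * a\<^sup>2) / sqrt (mom \<kappa> a (int i, 0))"
    using assms prod_x_wt[OF assms(1), of i a]
    by (simp add: beta_wt_def real_sqrt_mult mult.commute)
  then show ?thesis
    using True by (simp add: real_sqrt_divide) (simp add: mom_def)
next
  case False
  then show ?thesis using assms by (auto simp: beta_wt_def mom_def)
qed

lemma mom_edge_decomposition: "mom \<kappa> a (int i, 0) = (if i = 0 then 1 - \<kappa>\<^sup>2 else 0) + \<kappa>\<^sup>2 / 2 + \<kappa>\<^sup>2 / 2 / (real i + 1)"
  unfolding mom_edge by (simp add: divide_simps) (simp add: algebra_simps)

section \<open>Arithmetic of the two thresholds\<close>

lemma le_sqrt_quotient_iff:
  fixes \<kappa> N D :: real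
  assumes "0 < \<kappa>" "0 < N" "0 < D" "c = D / N"
  shows "0 \<le> 1 - \<kappa>\<^sup>2 * c \<longleftrightarrow> \<kappa> \<le> sqrt (N / D)"
proof -
  have "\<kappa> \<le> sqrt (N / D) \<longleftrightarrow> \<kappa>\<^sup>2 \<le> N / D"
    using assms by (metis less_imp_le real_le_rsqrt real_sqrt_le_iff real_sqrt_unique)
  then show ?thesis unfolding assms(4) using assms(1-3) by (simp add: field_simps)
qed

text \<open>Expanded in \<open>t = 1/2 - A \<ge> 0\<close>, both quadratics have positive
  coefficients.\<close>

lemma denominators_pos:
  fixes A :: real
  assumes "A \<le> 1/2"
  shows "0 < 157 - 360 * A + 144 * A\<^sup>2" "0 < 6238 - 15015 * A + 6300 * A\<^sup>2"
proof -
  define t where "t = 1/2 - A"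
  have A: "A = 1/2 - t" and t: "0 \<le> t" using assms by (simp_all add: t_def)
  have "157 - 360 * A + 144 * A\<^sup>2 = 13 + 216 * t + 144 * t\<^sup>2"
    "6238 - 15015 * A + 6300 * A\<^sup>2 = 611/2 + 8715 * t + 6300 * t\<^sup>2"
    by (simp_all add: A power2_eq_square algebra_simps)
  moreover have "0 < 13 + 216 * t + 144 * t\<^sup>2" "0 < 611/2 + 8715 * t + 6300 * t\<^sup>2"
    using t by (intro add_pos_nonneg; simp)+
  ultimately show "0 < 157 - 360 * A + 144 * A\<^sup>2" "0 < 6238 - 15015 * A + 6300 * A\<^sup>2"
    by simp_all
qed

text \<open>After cross-multiplication the cubic terms cancel, and in \<open>t = 1/2 - A\<close> the
  remaining quadratic has positive coefficients.\<close>

lemma h2_less_h2_21: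
  assumes "b\<^sup>2 \<le> 1/2"
  shows "h2 b < h2_21 b"
proof -
  define A where "A = b\<^sup>2"
  have A: "A \<le> 1/2" and b4: "b ^ 4 = A\<^sup>2"
    using assms by (simp_all add: A_def)
  note D = denominators_pos[OF A]
  define t where "t = 1/2 - A"
  have At: "A = 1/2 - t" and t: "0 \<le> t" using A by (simp_all add: t_def)
  have "225 * (15 - 28 * A) * (157 - 360 * A + 144 * A\<^sup>2) - 9 * (9 - 16 * A) * (6238 - 15015 * A + 6300 * A\<^sup>2)
      = 9 * (39/2 + 897 * t + 9060 * t\<^sup>2)"
    by (simp add: At power2_eq_square algebra_simps)
  moreover have "0 < 39/2 + 897 * t + 9060 * t\<^sup>2"
    using t by (intro add_pos_nonneg) simp_all
  ultimately have "9 * (9 - 16 * A) / (157 - 360 * A + 144 * A\<^sup>2)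
      < 225 * (15 - 28 * A) / (6238 - 15015 * A + 6300 * A\<^sup>2)"
    using D by (subst frac_less_eq) (auto intro: divide_neg_pos)
  then show ?thesis
    unfolding h2_def h2_21_def A_def[symmetric] b4 by simp
qed

text \<open>The coefficients solve the two stationarity equations by Cramer's rule; \<open>D\<close>
  is 960 times the determinant of the system.\<close>

lemma edge_minimum_1:
  fixes A :: real
  assumes A: "A \<le> 1/2"
  defines "D \<equiv> 9 - 16 * A"
  shows "(5 - 9 * A) / (9 * D) * x\<^sup>2 \<le> edge_form 1 A x y w"
    and "edge_form 1 A 1 ((56 * A - 32) / D) (10 * (7 - 12 * A) / (3 * D)) = (5 - 9 * A) / (9 * D)"
proof -
  have D: "D \<noteq> 0" using A by (simp add: D_def)
  show "(5 - 9 * A) / (9 * D) * x\<^sup>2 \<le> edge_form 1 A x y w"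
    "edge_form 1 A 1 ((56 * A - 32) / D) (10 * (7 - 12 * A) / (3 * D)) = (5 - 9 * A) / (9 * D)"
    by (rule edge_form_minimum[where b = "(56 * A - 32) / D" and c = "10 * (7 - 12 * A) / (3 * D)", OF A]; use D in \<open>simp add: divide_simps\<close>; simp add: D_def algebra_simps)+
qed

text \<open>As for exponent 1, with \<open>D\<close> now 2205 times the determinant.\<close>

lemma edge_minimum_2:
  fixes A :: real
  assumes A: "A \<le> 1/2"
  defines "D \<equiv> 15 - 28 * A"
  shows "(512 - 960 * A) / (225 * D) * x\<^sup>2 \<le> edge_form 2 A x y w"
    and "edge_form 2 A 1 (14 * (24 * A - 13) / (3 * D)) (21 * (11 - 20 * A) / (5 * D)) = (512 - 960 * A) / (225 * D)"
proof -
  have D: "D \<noteq> 0" using A by (simp add: D_def)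
  show "(512 - 960 * A) / (225 * D) * x\<^sup>2 \<le> edge_form 2 A x y w"
    "edge_form 2 A 1 (14 * (24 * A - 13) / (3 * D)) (21 * (11 - 20 * A) / (5 * D)) = (512 - 960 * A) / (225 * D)"
    by (rule edge_form_minimum[where b = "14 * (24 * A - 13) / (3 * D)" and c = "21 * (11 - 20 * A) / (5 * D)", OF A]; use D in \<open>simp add: divide_simps\<close>; simp add: D_def algebra_simps)+
qed

theorem theorem5p4:
  fixes \<kappa> a :: real
  assumes "0 < \<kappa>" and "\<kappa> < 1" and "0 < a" and "a \<le> sqrt (1/2)"
  shows "W \<kappa> a \<in> H0
    \<and> (W \<kappa> a \<in> H2 \<longleftrightarrow> \<kappa> \<le> h2 a)
    \<and> (op_power 2 1 (W \<kappa> a) \<in> H2 \<longleftrightarrow> \<kappa> \<le> h2_21 a)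
    \<and> (\<forall>b\<in>{0<..sqrt (1/2)}. h2 b < h2_21 b)"
proof -
  have sq: "b\<^sup>2 \<le> 1/2" if "0 < b" "b \<le> sqrt (1/2)" for b :: real
    using power_mono[OF that(2), of 2] that(1) by simp
  have a2: "a\<^sup>2 \<le> 1/2" by (rule sq) fact+
  have a4: "a ^ 4 = (a\<^sup>2)\<^sup>2" by simp
  have k2: "\<kappa>\<^sup>2 \<le> 1" "0 \<le> \<kappa>\<^sup>2" using assms by (simp_all add: power_le_one)
  have ka: "\<kappa>\<^sup>2 * a\<^sup>2 \<le> \<kappa>\<^sup>2 / 2" using mult_left_mono[OF a2 k2(2)] by simp
  then have ka': "\<kappa>\<^sup>2 * a\<^sup>2 \<le> \<kappa>\<^sup>2" using k2 by linarith
  have nz: "a \<noteq> 0" "\<kappa> \<noteq> 0" using assms by auto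
  have pos: "0 < mom \<kappa> a k" for k using nz by (intro mom_pos)
  have edge: "\<kappa>\<^sup>2 / 2 \<le> mom \<kappa> a (int i, 0)" for i
    unfolding mom_edge_decomposition using k2 by simp
  have b1: "mom \<kappa> a (int (i + 1), int (j + 0)) \<le> mom \<kappa> a (int i, int j)" for i j
  proof (cases "j = 0")
    case True
    have "\<kappa>\<^sup>2 / 2 / (real (i + 1) + 1) \<le> \<kappa>\<^sup>2 / 2 / (real i + 1)"
      using k2 by (intro divide_left_mono) auto
    then show ?thesis using True k2 mom_edge_decomposition[of \<kappa> a i] mom_edge_decomposition[of \<kappa> a "i + 1"]
      by (auto split: if_splits)
  qed (use ka' k2 in \<open>auto simp: mom_def\<close>)
  have b2: "mom \<kappa> a (int (i + 0), int (j + 1)) \<le> mom \<kappa> a (int i, int j)" for i j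
  proof (cases "j = 0")
    case True
    have "mom \<kappa> a (int i, 1) = (if i = 0 then \<kappa>\<^sup>2 else \<kappa>\<^sup>2 * a\<^sup>2)" "mom \<kappa> a (0, 0) = 1"
      by (simp_all add: mom_def)
    then show ?thesis using True edge[of i] ka k2 by (cases "i = 0") simp_all
  qed (simp add: mom_def)
  define T1 T2 where T12: "T1 = weighted_translation (\<lambda>(i, j). (i + 1, j + 0)) (alpha_wt \<kappa> a)"
    "T2 = weighted_translation (\<lambda>(i, j). (i + 0, j + 1)) (beta_wt \<kappa> a)"
  have W: "W \<kappa> a = (T1, T2)"
    by (simp add: W_def weighted_shift_def T12)
  note T1 = weighted_translation_moment_shift[OF pos b1 alpha_wt_eq[OF assms(1,3)], folded T12]
  note T2 = weighted_translation_moment_shift[OF pos b2 beta_wt_eq[OF assms(1,3)], folded T12]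
  obtain T1' T2' where S1: "moment_shift (mom \<kappa> a) (int 1, 0) T1 T1'"
    and S2: "moment_shift (mom \<kappa> a) (0, 1) T2 T2'"
    using T1(1) T2(1) by auto
  \<comment> \<open>The square of \<open>T1\<close> is a shift by \<open>(2, 0)\<close> for the same
    moments, so the power is the case \<open>h = 2\<close> of the criterion and need not be split
    into direct summands.\<close>
  have "moment_shift (mom \<kappa> a) ((int 1, 0) + (int 1, 0)) (T1 \<circ> T1) (T1' \<circ> T1')"
    by (rule moment_shift_comp[OF pos S1 S1])
  then have S11: "moment_shift (mom \<kappa> a) (int 2, 0) (T1 \<circ> T1) (T1' \<circ> T1')" by simp
  have sub1: "subnormal T1" "subnormal (T1 \<circ> T1)"
  proof -
    have bcl: "bounded_clinear T1" using S1 by (simp add: moment_shift_def)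
    \<comment> \<open>Row 0 has an atom at each end and Lebesgue measure; the rows above it have the
      two atoms only.\<close>
    define P Q R where "P j = (if j = 0 then 1 - \<kappa>\<^sup>2 else \<kappa>\<^sup>2 - \<kappa>\<^sup>2 * a\<^sup>2)"
      and "Q j = (if j = 0 then \<kappa>\<^sup>2 / 2 else \<kappa>\<^sup>2 * a\<^sup>2)"
      and "R j = (if j = 0 then \<kappa>\<^sup>2 / 2 else 0)" for j :: nat
    have dec: "mom \<kappa> a (int i, int j) = (if i = 0 then P j else 0) + Q j + R j / (real i + 1)" for i j
    proof (cases "j = 0")
      case True
      then show ?thesis using mom_edge_decomposition[of \<kappa> a i] by (simp add: P_def Q_def R_def)
    qed (simp add: mom_def P_def Q_def R_def)
    have nonneg: "0 \<le> P j" "0 \<le> Q j" "0 \<le> R j" for j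
      using k2 ka' by (auto simp: P_def Q_def R_def)
    have "coord (T1 f) (id (0, j)) = 0" for f j
      using T1(2)[of 0 j f] by simp
    moreover have "coord (T1 f) (id (Suc i, j))
        = of_real (sqrt (mom \<kappa> a (int (Suc i), int j) / mom \<kappa> a (int i, int j))) * coord f (id (i, j))" for f i j
      using T1(3)[of f i j] alpha_wt_eq[OF assms(1,3), of i j] by simp
    ultimately show "subnormal T1" "subnormal (T1 \<circ> T1)"
      using subnormal_of_berger[of T1 id "\<lambda>i j. mom \<kappa> a (int i, int j)" P Q R, OF bcl _ _ _ pos nonneg dec]
      by simp_all
  qed
  have sub2: "subnormal T2"
  proof -
    have bcl: "bounded_clinear T2" using S2 by (simp add: moment_shift_def)
    \<comment> \<open>A column is constant from height 1 on, so its measure has only the atoms 0 and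
      1. For \<open>i > 0\<close> the mass at 0 is nonnegative because
      \<open>a\<^sup>2 \<le> 1/2\<close> and the edge moments are at least
      \<open>\<kappa>\<^sup>2 / 2\<close>.\<close>
    define P Q R where "P i = mom \<kappa> a (int i, 0) - (if i = 0 then \<kappa>\<^sup>2 else \<kappa>\<^sup>2 * a\<^sup>2)"
      and "Q i = (if i = 0 then \<kappa>\<^sup>2 else \<kappa>\<^sup>2 * a\<^sup>2)" and "R i = (0 :: real)" for i :: nat
    have dec: "mom \<kappa> a (int i, int j) = (if j = 0 then P i else 0) + Q i + R i / (real j + 1)" for i j
      by (auto simp: mom_def P_def Q_def R_def)
    have nonneg: "0 \<le> P i" "0 \<le> Q i" "0 \<le> R i" for i
      using k2 ka edge[of i] by (auto simp: P_def Q_def R_def mom_edge[of _ _ 0, simplified])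
    have "coord (T2 f) (prod.swap (0, i)) = 0" for f i
      using T2(2)[of i 0 f] by simp
    moreover have "coord (T2 f) (prod.swap (Suc j, i))
        = of_real (sqrt (mom \<kappa> a (int i, int (Suc j)) / mom \<kappa> a (int i, int j))) * coord f (prod.swap (j, i))" for f i j
      using T2(3)[of f i j] beta_wt_eq[OF assms(1,3), of i j] by simp
    ultimately show "subnormal T2"
      using subnormal_of_berger(1)[of T2 prod.swap "\<lambda>j i. mom \<kappa> a (int i, int j)" P Q R, OF bcl _ _ _ pos nonneg dec]
      by simp
  qed
  have two: "(2 :: nat) \<noteq> 0" by simp
  note iff1 = two_hyponormal_iff[OF nz(1) a2 nz(2) one_neq_zero S1 S2 edge_minimum_1[OF a2]]
  note iff2 = two_hyponormal_iff[OF nz(1) a2 nz(2) two S11 S2 edge_minimum_2[OF a2]]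
  have H0: "W \<kappa> a \<in> H0"
    using sub1 sub2 iff1(1) by (simp add: W H0_def)
  have pow: "op_power 2 1 (W \<kappa> a) = (T1 \<circ> T1, T2)"
    by (simp add: W op_power_def numeral_2_eq_2)
  have H0': "(T1 \<circ> T1, T2) \<in> H0"
    using sub1 sub2 iff2(1) by (simp add: H0_def)
  note D = denominators_pos[OF a2]
  have N: "0 < 9 * (9 - 16 * a\<^sup>2)" "0 < 225 * (15 - 28 * a\<^sup>2)" using a2 by simp_all
  have quotient: "c - p / n = d / n" if "0 < n" "d = c * n - p" for c d n p :: real
    using that by (simp add: diff_divide_distrib)
  have q1: "2 - a\<^sup>2 - (5 - 9 * a\<^sup>2) / (9 * (9 - 16 * a\<^sup>2)) = (157 - 360 * a\<^sup>2 + 144 * (a\<^sup>2)\<^sup>2) / (9 * (9 - 16 * a\<^sup>2))"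
    by (rule quotient[OF N(1)]) (simp add: algebra_simps power2_eq_square[of "a\<^sup>2"])
  have "W \<kappa> a \<in> H2 \<longleftrightarrow> two_hyponormal (T1, T2)"
    using H0 by (simp add: H2_def W)
  also note iff1(2)
  also note le_sqrt_quotient_iff[OF assms(1) N(1) D(1) q1]
  finally have 2: "W \<kappa> a \<in> H2 \<longleftrightarrow> \<kappa> \<le> h2 a"
    unfolding h2_def a4 .
  have q2: "2 - a\<^sup>2 - (512 - 960 * a\<^sup>2) / (225 * (15 - 28 * a\<^sup>2))
      = (6238 - 15015 * a\<^sup>2 + 6300 * (a\<^sup>2)\<^sup>2) / (225 * (15 - 28 * a\<^sup>2))"
    by (rule quotient[OF N(2)]) (simp add: algebra_simps power2_eq_square[of "a\<^sup>2"])
  have "op_power 2 1 (W \<kappa> a) \<in> H2 \<longleftrightarrow> two_hyponormal (T1 \<circ> T1, T2)"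
    using H0' unfolding pow H2_def by simp
  also note iff2(2)
  also note le_sqrt_quotient_iff[OF assms(1) N(2) D(2) q2]
  finally have 3: "op_power 2 1 (W \<kappa> a) \<in> H2 \<longleftrightarrow> \<kappa> \<le> h2_21 a"
    unfolding h2_21_def a4 .
  have "h2 b < h2_21 b" if "b \<in> {0<..sqrt (1/2)}" for b
    by (rule h2_less_h2_21, rule sq) (use that in auto)
  then show ?thesis using H0 2 3 by blast
qed

end
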